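(* Let $\Omega$ be a finite state space, $r,r'\in\mathbb{H}_1\Omega$ two atomic programs (each regarded as a single-event structure), $b,c$ tests (also regarded as single-event structures), and $\mathcal{E},\mathcal{F}$ bundle event structures with internal probability over $\Omega$. Write $r^{*}=r*1$. Then \begin{align*} r^{*}\|r^{*}&\sqsubseteq_{\mathrm{sim}}r^{*},\\ r^{*}\|r'&\sqsubseteq_{\mathrm{sim}}r*(r'\cdot r^{*}),\\ r^{*}\|(b\cdot\mathcal{E}+c\cdot\mathcal{F})&\sqsubseteq_{\mathrm{sim}}r*\bigl(b\cdot(r^{*}\|\mathcal{E})+c\cdot(r^{*}\|\mathcal{F})\bigr),\\ r^{*}\|(r'\cdot\mathcal{E})&\sqsubseteq_{\mathrm{sim}}r*\bigl(r'\cdot(r^{*}\|\mathcal{E})\bigr). \end{align*}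
   Context: **Programs.** $\Omega$ is a fixed finite set of states. $\mathbb{D}\Omega$ is the set of distributions on $\Omega$, viewed inside $\mathbb{R}^\Omega$; $\delta_s$ is the point distribution at $s$. $\mathbb{H}_1\Omega$ is the set of maps $r:\Omega\to\mathcal{P}(\mathbb{D}\Omega)$ such that each $r(s)$ is non-empty, convex and topologically closed. A test is a map $b:\Omega\to\mathcal{P}(\mathbb{D}\Omega)$ with $b(s)\subseteq\{\delta_s\}$. $\overline{\mathbb{H}}_1\Omega$ is $\mathbb{H}_1\Omega$ together with all tests, ordered by $r\sqsubseteq_{\mathbb{H}}r'$ iff $r(s)\subseteq r'(s)$ for all $s$. $\delta$ denotes the program $\delta(s)=\{\delta_s\}$. **ipBES.** A bundle event structure with internal probability (ipBES) is $\mathcal{E}=(E,\mapsto,\#,\lambda,\mathbf{\Phi})$ where $E$ is a set of events; $\#$ is an irreflexive symmetric relation on $E$; for $x,x'\subseteq E$, $x\#x'$ means $e\#e'$ for all $e\in x,e'\in x'$ with $e\ne e'$; $\mapsto\subseteq\mathcal{P}(E)\times E$ satisfies $x\#x$ whenever $x\mapsto e$; $\lambda:E\to\overline{\mathbb{H}}_1\Omega$; $\mathbf{\Phi}\subseteq\mathcal{P}(E)$ with $x\#x$ for $x\in\mathbf{\Phi}$. $\mathbf{in}(\mathcal{E})$ is the set of initial events, i.e. events $e$ with no bundle $x\mapsto e$. **Traces.** A finite trace is a finite sequence $e_1\cdots e_n$ of distinct, pairwise non-conflicting events such that for every $j$ and every bundle $x\mapsto e_j$ there is $i<j$ with $e_i\in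 x$. $\mathcal{T}(\mathcal{E})$ is the set of finite traces (empty trace $\emptyset$), $\mathcal{T}_{\max}(\mathcal{E})$ the set of prefix-maximal ones. A trace $\alpha$ is weakly maximal if it is maximal or there are events $e_1,\dots,e_n$ with $\alpha e_1\cdots e_n\in\mathcal{T}_{\max}(\mathcal{E})$ and $\delta\sqsubseteq_{\mathbb{H}}\lambda(e_i)$ for all $i$. **t-simulation.** A function $f:\mathcal{T}(\mathcal{E})\to\mathcal{T}(\mathcal{F})$ is a t-simulation if: (i) $f(\emptyset)=\emptyset$ and $f^{-1}(\beta)$ is finite for every $\beta\in\mathcal{T}(\mathcal{F})$; (ii) if $\alpha e\in\mathcal{T}(\mathcal{E})$ then either $f(\alpha e)=f(\alpha)$ and $\lambda(e)\sqsubseteq_{\mathbb{H}}\delta$, or there is an event $e'$ of $\mathcal{F}$ with $\lambda(e)\sqsubseteq_{\mathbb{H}}\lambda(e')$ and $f(\alpha e)=f(\alpha)e'$; (iii) if $\alpha e$ is maximal in $\mathcal{T}(\mathcal{E})$ then $f(\alpha e)=f(\alpha)e'$ for some $e'$ with $\lambda(e)\sqsubseteq_{\mathbb{H}}\lambda(e')$, and $f(\alpha e)$ is weakly maximal in $\mathcal{T}(\mathcal{F})$. $\mathcal{E}\sqsubseteq_{\mathrm{sim}}\mathcal{F}$ means there is a t-simulation from $\mathcal{E}$ to $\mathcal{F}$. **Operations on ipBES** (event sets of the operands are taken disjoint, using fresh copies if necessary). - An atomic action $a\in\overline{\mathbb{H}}_1\Omega$ is identified with the structure with one event $e$ labelled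 $a$, no bundles, no conflicts, and $\mathbf{\Phi}=\{\{e\}\}$; $1$ is the structure of the atomic action $\delta$. - $0$ is the structure with no events and $\mathbf{\Phi}=\emptyset$; by convention $0+\mathcal{E}=\mathcal{E}+0=\mathcal{E}$ and $0\cdot\mathcal{E}=\mathcal{E}\cdot0=\mathcal{E}$. - $\mathcal{E}+\mathcal{F}$ has events $E\cup F$, bundles $\mapsto_{\mathcal{E}}\cup\mapsto_{\mathcal{F}}$, labels $\lambda_{\mathcal{E}}\cup\lambda_{\mathcal{F}}$, exit sets $\{x\cup y: x\in\mathbf{\Phi}_{\mathcal{E}},y\in\mathbf{\Phi}_{\mathcal{F}}\}$, and conflict $\#_{\mathcal{E}}\cup\#_{\mathcal{F}}$ together with the symmetric closure of $\mathbf{in}(\mathcal{E})\times\mathbf{in}(\mathcal{F})$ and of all $x\times y$ with $x\in\mathbf{\Phi}_{\mathcal{E}}$, $y\in\mathbf{\Phi}_{\mathcal{F}}$. - $\mathcal{E}\cdot\mathcal{F}$ has events $E\cup F$, conflict $\#_{\mathcal{E}}\cup\#_{\mathcal{F}}$, bundles $\mapsto_{\mathcal{E}}\cup\mapsto_{\mathcal{F}}\cup\{x\mapsto e: x\in\mathbf{\Phi}_{\mathcal{E}},e\in\mathbf{in}(\mathcal{F})\}$, labels $\lambda_{\mathcal{E}}\cup\lambda_{\mathcal{F}}$, exit sets $\mathbf{\Phi}_{\mathcal{F}}$. - $\mathcal{E}\|\mathcal{F}=(E\cup F,\ \mapsto_{\mathcal{E}}\cup\mapsto_{\mathcal{F}},\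 \#_{\mathcal{E}}\cup\#_{\mathcal{F}},\ \lambda_{\mathcal{E}}\cup\lambda_{\mathcal{F}},\ \mathbf{\Phi}_{\mathcal{E}}\cup\mathbf{\Phi}_{\mathcal{F}})$. - $\mathcal{E}*\mathcal{F}$ (binary Kleene star) is the supremum (limit) of the increasing sequence $\mathcal{F},\ \mathcal{F}+\mathcal{E}\cdot\mathcal{F},\ \mathcal{F}+\mathcal{E}\cdot(\mathcal{F}+\mathcal{E}\cdot\mathcal{F}),\dots$. Explicitly, for $\mathcal{E}\neq0$, take disjoint copies $\mathcal{E}_k,\mathcal{F}_k$ ($k\ge0$); the events are those of all copies with their labels; the bundles are those of the copies plus $x\mapsto e$ for $x\in\mathbf{\Phi}_{\mathcal{E}_k}$, $e\in\mathbf{in}(\mathcal{F}_{k+1})\cup\mathbf{in}(\mathcal{E}_{k+1})$; the conflicts are those of the copies plus the symmetric closure of $\mathbf{in}(\mathcal{F}_k)\times\mathbf{in}(\mathcal{E}_k)$ and of $x\times y$ for $x\in\mathbf{\Phi}_{\mathcal{F}_k},y\in\mathbf{\Phi}_{\mathcal{F}_j}$, $j\ne k$; the exit sets are the unions $\bigcup_k x_k$ with $x_k\in\mathbf{\Phi}_{\mathcal{F}_k}$. *)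

theory Defs
  imports "HOL-Analysis.Analysis" "HOL-Library.Sublist"
begin

section \<open>Programs over a finite state space\<close>

text \<open>The state space is a finite type; a distribution is a point of the probability simplex of
  \<open>real ^ 's\<close>, so that convexity and closedness are the library notions of that space.\<close>

type_synonym 's prog = "'s \<Rightarrow> (real ^ 's) set"

definition distributions :: "(real ^ 's::finite) set" where
  "distributions = {\<mu>. (\<forall>s. 0 \<le> \<mu> $ s) \<and> (\<Sum>s\<in>UNIV. \<mu> $ s) = 1}"

definition point_dist :: "'s::finite \<Rightarrow> real ^ 's" where
  "point_dist s = axis s 1"

definition H1 :: "('s::finite) prog set" where
  "H1 = {r. \<forall>s. r s \<subseteq> distributions \<and> r s \<noteq> {} \<and> convex (r s) \<and> closed (r s)}"

definition tests :: "('s::finite) prog set" where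
  "tests = {b. \<forall>s. b s \<subseteq> {point_dist s}}"

definition H1_bar :: "('s::finite) prog set" where
  "H1_bar = H1 \<union> tests"

definition prog_le :: "('s::finite) prog \<Rightarrow> 's prog \<Rightarrow> bool" (infix \<open>\<sqsubseteq>\<^sub>H\<close> 50) where
  "r \<sqsubseteq>\<^sub>H r' \<longleftrightarrow> (\<forall>s. r s \<subseteq> r' s)"

definition skip :: "('s::finite) prog" where
  "skip s = {point_dist s}"


section \<open>Bundle event structures with internal probability\<close>

text \<open>The label function is total on the type of events; its values outside \<open>events\<close> are
  irrelevant.\<close>

record ('e, 's) bes =
  events :: "'e set"
  bundles :: "('e set \<times> 'e) set"
  conflict :: "('e \<times> 'e) set"
  label :: "'e \<Rightarrow> 's prog"
  exits :: "'e set set"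

definition set_conflict :: "('e, 's) bes \<Rightarrow> 'e set \<Rightarrow> 'e set \<Rightarrow> bool" where
  "set_conflict \<E> x x' \<longleftrightarrow> (\<forall>e\<in>x. \<forall>e'\<in>x'. e \<noteq> e' \<longrightarrow> (e, e') \<in> conflict \<E>)"

definition ipbes :: "('e, 's::finite) bes \<Rightarrow> bool" where
  "ipbes \<E> \<longleftrightarrow>
     conflict \<E> \<subseteq> events \<E> \<times> events \<E> \<and> irrefl (conflict \<E>) \<and> sym (conflict \<E>) \<and>
     bundles \<E> \<subseteq> Pow (events \<E>) \<times> events \<E> \<and>
     (\<forall>(x, e)\<in>bundles \<E>. set_conflict \<E> x x) \<and>
     (\<forall>e\<in>events \<E>. label \<E> e \<in> H1_bar) \<and>
     exits \<E> \<subseteq> Pow (events \<E>) \<and>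
     (\<forall>x\<in>exits \<E>. set_conflict \<E> x x)"

definition initial :: "('e, 's) bes \<Rightarrow> 'e set" where
  "initial \<E> = {e \<in> events \<E>. \<nexists>x. (x, e) \<in> bundles \<E>}"


section \<open>Traces and t-simulations\<close>

definition traces :: "('e, 's) bes \<Rightarrow> 'e list set" where
  "traces \<E> = {\<alpha>. set \<alpha> \<subseteq> events \<E> \<and> distinct \<alpha> \<and>
     (\<forall>e\<in>set \<alpha>. \<forall>e'\<in>set \<alpha>. (e, e') \<notin> conflict \<E>) \<and>
     (\<forall>j<length \<alpha>. \<forall>x. (x, \<alpha> ! j) \<in> bundles \<E> \<longrightarrow> (\<exists>i<j. \<alpha> ! i \<in> x))}"

definition max_traces :: "('e, 's) bes \<Rightarrow> 'e list set" where
  "max_traces \<E> = {\<alpha> \<in> traces \<E>. \<forall>\<beta>\<in>traces \<E>. prefix \<alpha> \<beta> \<longrightarrow> \<beta> = \<alpha>}"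

definition weakly_maximal :: "('e, 's::finite) bes \<Rightarrow> 'e list \<Rightarrow> bool" where
  "weakly_maximal \<E> \<alpha> \<longleftrightarrow> \<alpha> \<in> traces \<E> \<and>
     (\<alpha> \<in> max_traces \<E> \<or>
      (\<exists>es. \<alpha> @ es \<in> max_traces \<E> \<and> (\<forall>e\<in>set es. skip \<sqsubseteq>\<^sub>H label \<E> e)))"

definition t_simulation ::
  "('e, 's::finite) bes \<Rightarrow> ('f, 's) bes \<Rightarrow> ('e list \<Rightarrow> 'f list) \<Rightarrow> bool" where
  "t_simulation \<E> \<F> f \<longleftrightarrow>
     (\<forall>\<alpha>\<in>traces \<E>. f \<alpha> \<in> traces \<F>) \<and>
     f [] = [] \<and>
     (\<forall>\<beta>\<in>traces \<F>. finite {\<alpha> \<in> traces \<E>. f \<alpha> = \<beta>}) \<and>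
     (\<forall>\<alpha> e. \<alpha> @ [e] \<in> traces \<E> \<longrightarrow>
        (f (\<alpha> @ [e]) = f \<alpha> \<and> label \<E> e \<sqsubseteq>\<^sub>H skip) \<or>
        (\<exists>e'\<in>events \<F>. label \<E> e \<sqsubseteq>\<^sub>H label \<F> e' \<and> f (\<alpha> @ [e]) = f \<alpha> @ [e'])) \<and>
     (\<forall>\<alpha> e. \<alpha> @ [e] \<in> max_traces \<E> \<longrightarrow>
        (\<exists>e'\<in>events \<F>. label \<E> e \<sqsubseteq>\<^sub>H label \<F> e' \<and> f (\<alpha> @ [e]) = f \<alpha> @ [e']) \<and>
        weakly_maximal \<F> (f (\<alpha> @ [e])))"

definition sim :: "('e, 's::finite) bes \<Rightarrow> ('f, 's) bes \<Rightarrow> bool" (infix \<open>\<sqsubseteq>\<^sub>s\<^sub>i\<^sub>m\<close> 50) where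
  "\<E> \<sqsubseteq>\<^sub>s\<^sub>i\<^sub>m \<F> \<longleftrightarrow> (\<exists>f. t_simulation \<E> \<F> f)"


section \<open>Operations\<close>

text \<open>Disjointness of the operands is enforced by the sum type of events.\<close>

definition atomic :: "('s::finite) prog \<Rightarrow> (unit, 's) bes" where
  "atomic a = \<lparr>events = {()}, bundles = {}, conflict = {}, label = (\<lambda>_. a), exits = {{()}}\<rparr>"

definition one :: "(unit, 's::finite) bes" where
  "one = atomic skip"

definition is_zero :: "('e, 's) bes \<Rightarrow> bool" where
  "is_zero \<E> \<longleftrightarrow> events \<E> = {} \<and> exits \<E> = {}"

definition par :: "('e, 's) bes \<Rightarrow> ('f, 's) bes \<Rightarrow> ('e + 'f, 's) bes" (infixl \<open>\<parallel>\<^sub>b\<close> 60) where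
  "\<E> \<parallel>\<^sub>b \<F> = \<lparr>events = Inl ` events \<E> \<union> Inr ` events \<F>,
     bundles = {(Inl ` x, Inl e) |x e. (x, e) \<in> bundles \<E>} \<union>
               {(Inr ` x, Inr e) |x e. (x, e) \<in> bundles \<F>},
     conflict = {(Inl e, Inl e') |e e'. (e, e') \<in> conflict \<E>} \<union>
                {(Inr e, Inr e') |e e'. (e, e') \<in> conflict \<F>},
     label = case_sum (label \<E>) (label \<F>),
     exits = {Inl ` x |x. x \<in> exits \<E>} \<union> {Inr ` x |x. x \<in> exits \<F>}\<rparr>"

text \<open>The conventions \<open>0 + \<E> = \<E> + 0 = \<E>\<close> and \<open>0 \<cdot> \<E> = \<E> \<cdot> 0 = \<E>\<close> hold up to the tagging of
  events: if one operand of \<open>\<parallel>\<^sub>b\<close> is zero, the result is just the tagged copy of the other one.\<close>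

definition plus_bes :: "('e, 's) bes \<Rightarrow> ('f, 's) bes \<Rightarrow> ('e + 'f, 's) bes" (infixl \<open>+\<^sub>b\<close> 65) where
  "\<E> +\<^sub>b \<F> = (if is_zero \<E> \<or> is_zero \<F> then \<E> \<parallel>\<^sub>b \<F> else
     let C = Inl ` initial \<E> \<times> Inr ` initial \<F> \<union>
             (\<Union>x\<in>exits \<E>. \<Union>y\<in>exits \<F>. Inl ` x \<times> Inr ` y)
     in (\<E> \<parallel>\<^sub>b \<F>)\<lparr>conflict := conflict (\<E> \<parallel>\<^sub>b \<F>) \<union> C \<union> C\<inverse>,
          exits := {Inl ` x \<union> Inr ` y |x y. x \<in> exits \<E> \<and> y \<in> exits \<F>}\<rparr>)"

definition seq_bes :: "('e, 's) bes \<Rightarrow> ('f, 's) bes \<Rightarrow> ('e + 'f, 's) bes" (infixl \<open>\<cdot>\<^sub>b\<close> 70) where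
  "\<E> \<cdot>\<^sub>b \<F> = (if is_zero \<E> \<or> is_zero \<F> then \<E> \<parallel>\<^sub>b \<F> else
     (\<E> \<parallel>\<^sub>b \<F>)\<lparr>bundles := bundles (\<E> \<parallel>\<^sub>b \<F>) \<union>
            {(Inl ` x, Inr e) |x e. x \<in> exits \<E> \<and> e \<in> initial \<F>},
          exits := {Inr ` y |y. y \<in> exits \<F>}\<rparr>)"

text \<open>The event \<open>(k, Inl e)\<close> is the copy of \<open>e\<close> in \<open>\<E>\<^sub>k\<close> and \<open>(k, Inr e)\<close> the copy of \<open>e\<close> in
  \<open>\<F>\<^sub>k\<close>.  This is the limit of \<open>\<F>\<close>, \<open>\<F> + \<E> \<cdot> \<F>\<close>, \<open>\<F> + \<E> \<cdot> (\<F> + \<E> \<cdot> \<F>)\<close>, ..., and is intended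
  for \<open>\<E> \<noteq> 0\<close> only.\<close>

definition star_bes :: "('e, 's) bes \<Rightarrow> ('f, 's) bes \<Rightarrow> (nat \<times> ('e + 'f), 's) bes"
  (infixr \<open>\<star>\<^sub>b\<close> 75) where
  "\<E> \<star>\<^sub>b \<F> =
     (let C = {((k, Inr e), (k, Inl e')) |k e e'. e \<in> initial \<F> \<and> e' \<in> initial \<E>} \<union>
              {((k, Inr e), (j, Inr e')) |k j e e' x y.
                 k \<noteq> j \<and> x \<in> exits \<F> \<and> y \<in> exits \<F> \<and> e \<in> x \<and> e' \<in> y}
      in \<lparr>events = UNIV \<times> events (\<E> \<parallel>\<^sub>b \<F>),
          bundles = {(Pair k ` x, (k, e)) |k x e. (x, e) \<in> bundles (\<E> \<parallel>\<^sub>b \<F>)} \<union>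
                    {((\<lambda>e. (k, Inl e)) ` x, (Suc k, e')) |k x e'.
                       x \<in> exits \<E> \<and> e' \<in> Inr ` initial \<F> \<union> Inl ` initial \<E>},
          conflict = {((k, e), (k, e')) |k e e'. (e, e') \<in> conflict (\<E> \<parallel>\<^sub>b \<F>)} \<union> C \<union> C\<inverse>,
          label = (\<lambda>(k, e). label (\<E> \<parallel>\<^sub>b \<F>) e),
          exits = {(\<Union>k. (\<lambda>e. (k, Inr e)) ` X k) |X. \<forall>k. X k \<in> exits \<F>}\<rparr>)"

text \<open>\<open>r\<^sup>* = r * 1\<close> for an atomic action \<open>r\<close>.\<close>

definition iter :: "('s::finite) prog \<Rightarrow> (nat \<times> (unit + unit), 's) bes" where
  "iter r = atomic r \<star>\<^sub>b one"

end

theory Submission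
  imports Defs
begin

text \<open>A trace of \<open>atomic r \<star>\<^sub>b \<H>\<close> consists of \<open>n\<close> loop events followed by a trace of the \<open>n\<close>-th copy
  of \<open>\<H>\<close>, and a trace of a parallel composition is a shuffle.  In \<open>r\<^sup>* \<parallel> r\<^sup>*\<close> the loop events of both
  sides are merged into one sequence, and only the second of the two exit events is kept.  In
  \<open>r\<^sup>* \<parallel> \<G>\<close>, where \<open>\<G>\<close> starts with a guard, the loop events before the guard
  select the copy that the guard enters, and everything after it is played inside that copy.  An exit
  event before the guard is dropped; since it is labelled \<open>skip\<close>, it can be added again at the end, so
  that the image of a maximal trace is weakly maximal.\<close>

section \<open>Traces of the compound structures\<close>

text \<open>Both maps are shaped by the clause on maximal traces, which forbids dropping their last
  event. When two iterations are merged, the first exit has no possible image, because the other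
  side may go on looping and a trace of \<open>iter r\<close> cannot continue after its exit; in a
  maximal trace the last event is the second exit. With a guard, an exit that precedes it has no
  counterpart yet, because the copy offers its own exit only after the guard; every maximal trace
  contains a guard, and from there on nothing is dropped. Labels are never compared strictly: a kept
  event goes to an event with the same label, and a dropped event is labelled \<open>skip\<close>.
  Preimages are finite because at most one event per iteration is lost and the length of the image
  bounds the loop indices. The last three inequalities differ only in what may follow the guard, so
  a single locale, stated in terms of trace sets, covers them.\<close>

definition enabled :: "('e, 's) bes \<Rightarrow> 'e set \<Rightarrow> 'e \<Rightarrow> bool" where
  "enabled \<E> A e \<longleftrightarrow> e \<in> events \<E> \<and> e \<notin> A \<and> (e, e) \<notin> conflict \<E> \<and>
     (\<forall>d\<in>A. (d, e) \<notin> conflict \<E> \<and> (e, d) \<notin> conflict \<E>) \<and>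
     (\<forall>x. (x, e) \<in> bundles \<E> \<longrightarrow> x \<inter> A \<noteq> {})"

lemma Nil_in_traces [simp]: "[] \<in> traces \<E>"
  by (simp add: traces_def)

text \<open>The conditions on a new last event refer to the earlier events only as a set, so traces
  become runs of a one-step relation and every trace set below is computed by
  \<open>rev_induct\<close>. The clause on \<open>(e, e)\<close> in \<open>enabled\<close> reflects
  that \<open>traces_def\<close> ranges over equal pairs too.\<close>

lemma traces_snoc: "\<alpha> @ [e] \<in> traces \<E> \<longleftrightarrow> \<alpha> \<in> traces \<E> \<and> enabled \<E> (set \<alpha>) e"
proof -
  have pre: "(\<exists>i<j. (\<alpha> @ [e]) ! i \<in> x) \<longleftrightarrow> (\<exists>i<j. \<alpha> ! i \<in> x)" if "j \<le> length \<alpha>" for j x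
    using that by (metis nth_append order_less_le_trans)
  have "(\<forall>j<length (\<alpha> @ [e]). \<forall>x. (x, (\<alpha> @ [e]) ! j) \<in> bundles \<E> \<longrightarrow> (\<exists>i<j. (\<alpha> @ [e]) ! i \<in> x)) \<longleftrightarrow>
    (\<forall>j<length \<alpha>. \<forall>x. (x, \<alpha> ! j) \<in> bundles \<E> \<longrightarrow> (\<exists>i<j. \<alpha> ! i \<in> x)) \<and>
    (\<forall>x. (x, e) \<in> bundles \<E> \<longrightarrow> (\<exists>i<length \<alpha>. \<alpha> ! i \<in> x))"
    by (simp add: All_less_Suc pre) (auto simp: pre nth_append_left)
  moreover have "(\<exists>i<length \<alpha>. \<alpha> ! i \<in> x) \<longleftrightarrow> x \<inter> set \<alpha> \<noteq> {}" for x
    by (metis IntI disjoint_iff in_set_conv_nth)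
  ultimately show ?thesis
    unfolding traces_def enabled_def by auto
qed

lemma traces_appendD: "\<alpha> @ \<beta> \<in> traces \<E> \<Longrightarrow> \<alpha> \<in> traces \<E>"
  by (induction \<beta> rule: rev_induct) (auto simp: traces_snoc simp flip: append_assoc)

lemma traces_Cons_initial: "e # \<alpha> \<in> traces \<E> \<Longrightarrow> e \<in> initial \<E>"
  using traces_appendD[of "[e]" \<alpha>] traces_snoc[of "[]" e]
  by (auto simp: enabled_def initial_def)

text \<open>A non-empty trace thus contains an initial event; this is the event that blocks the
  other branch of a sum and the next loop of a star.\<close>

lemma initial_in_hd: "\<alpha> \<in> traces \<E> \<Longrightarrow> \<alpha> \<noteq> [] \<Longrightarrow> hd \<alpha> \<in> initial \<E>"
  by (cases \<alpha>) (auto intro: traces_Cons_initial)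

lemma enabled_empty: "enabled \<E> {} e \<longleftrightarrow> e \<in> initial \<E> \<and> (e, e) \<notin> conflict \<E>"
  by (auto simp: enabled_def initial_def)

section \<open>Projections of a shuffle to its two components\<close>

definition lefts :: "('a + 'b) list \<Rightarrow> 'a list" where
  "lefts \<alpha> = map projl (filter isl \<alpha>)"

definition rights :: "('a + 'b) list \<Rightarrow> 'b list" where
  "rights \<alpha> = map projr (filter (\<lambda>x. \<not> isl x) \<alpha>)"

lemma lefts_simps [simp]:
  "lefts [] = []" "lefts (Inl a # \<alpha>) = a # lefts \<alpha>" "lefts (Inr b # \<alpha>) = lefts \<alpha>"
  "lefts (\<alpha> @ \<beta>) = lefts \<alpha> @ lefts \<beta>" "lefts (map Inl u) = u" "lefts (map Inr v) = []"
  "lefts (map (map_sum f g) \<alpha>) = map f (lefts \<alpha>)"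
proof -
  show "lefts (map Inl u) = u" by (induction u) (auto simp: lefts_def)
  show "lefts (map (map_sum f g) \<alpha>) = map f (lefts \<alpha>)"
  proof (induction \<alpha>)
    case (Cons x \<alpha>)
    then show ?case by (cases x) (auto simp: lefts_def)
  qed (auto simp: lefts_def)
qed (auto simp: lefts_def)

lemma rights_simps [simp]:
  "rights [] = []" "rights (Inl a # \<alpha>) = rights \<alpha>" "rights (Inr b # \<alpha>) = b # rights \<alpha>"
  "rights (\<alpha> @ \<beta>) = rights \<alpha> @ rights \<beta>" "rights (map Inl u) = []" "rights (map Inr v) = v"
  "rights (map (map_sum f g) \<alpha>) = map g (rights \<alpha>)"
proof -
  show "rights (map Inr v) = v" by (induction v) (auto simp: rights_def)
  show "rights (map (map_sum f g) \<alpha>) = map g (rights \<alpha>)"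
  proof (induction \<alpha>)
    case (Cons x \<alpha>)
    then show ?case by (cases x) (auto simp: rights_def)
  qed (auto simp: rights_def)
qed (auto simp: rights_def)

lemma set_lefts: "x \<in> set (lefts \<alpha>) \<longleftrightarrow> Inl x \<in> set \<alpha>"
  by (induction \<alpha>) (auto simp: lefts_def isl_def)

lemma set_rights: "x \<in> set (rights \<alpha>) \<longleftrightarrow> Inr x \<in> set \<alpha>"
proof (induction \<alpha>)
  case (Cons y \<alpha>)
  then show ?case by (cases y) auto
qed auto

lemma length_lefts_rights: "length \<alpha> = length (lefts \<alpha>) + length (rights \<alpha>)"
proof (induction \<alpha>)
  case (Cons y \<alpha>)
  then show ?case by (cases y) auto
qed auto

lemma rights_empty_iff: "rights \<alpha> = [] \<longleftrightarrow> \<alpha> = map Inl (lefts \<alpha>)"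
proof (induction \<alpha>)
  case (Cons y \<alpha>)
  then show ?case by (cases y) auto
qed auto

lemma par_simps:
  "Inl a \<in> events (\<E> \<parallel>\<^sub>b \<F>) \<longleftrightarrow> a \<in> events \<E>"
  "Inr b \<in> events (\<E> \<parallel>\<^sub>b \<F>) \<longleftrightarrow> b \<in> events \<F>"
  "(d, Inl a) \<in> conflict (\<E> \<parallel>\<^sub>b \<F>) \<longleftrightarrow> (\<exists>a'. d = Inl a' \<and> (a', a) \<in> conflict \<E>)"
  "(Inl a, d) \<in> conflict (\<E> \<parallel>\<^sub>b \<F>) \<longleftrightarrow> (\<exists>a'. d = Inl a' \<and> (a, a') \<in> conflict \<E>)"
  "(d, Inr b) \<in> conflict (\<E> \<parallel>\<^sub>b \<F>) \<longleftrightarrow> (\<exists>b'. d = Inr b' \<and> (b', b) \<in> conflict \<F>)"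
  "(Inr b, d) \<in> conflict (\<E> \<parallel>\<^sub>b \<F>) \<longleftrightarrow> (\<exists>b'. d = Inr b' \<and> (b, b') \<in> conflict \<F>)"
  "(x, Inl a) \<in> bundles (\<E> \<parallel>\<^sub>b \<F>) \<longleftrightarrow> (\<exists>y. x = Inl ` y \<and> (y, a) \<in> bundles \<E>)"
  "(x, Inr b) \<in> bundles (\<E> \<parallel>\<^sub>b \<F>) \<longleftrightarrow> (\<exists>y. x = Inr ` y \<and> (y, b) \<in> bundles \<F>)"
  by (auto simp: par_def)

lemma enabled_par_Inl: "enabled (\<E> \<parallel>\<^sub>b \<F>) A (Inl a) \<longleftrightarrow> enabled \<E> (Inl -` A) a"
proof -
  have "Inl ` y \<inter> A \<noteq> {} \<longleftrightarrow> y \<inter> Inl -` A \<noteq> {}" for y by auto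
  then have "(\<forall>x. (x, Inl a) \<in> bundles (\<E> \<parallel>\<^sub>b \<F>) \<longrightarrow> x \<inter> A \<noteq> {}) \<longleftrightarrow>
      (\<forall>y. (y, a) \<in> bundles \<E> \<longrightarrow> y \<inter> Inl -` A \<noteq> {})"
    unfolding par_simps by metis
  then show ?thesis unfolding enabled_def by (auto simp: par_simps)
qed

lemma enabled_par_Inr: "enabled (\<E> \<parallel>\<^sub>b \<F>) A (Inr b) \<longleftrightarrow> enabled \<F> (Inr -` A) b"
proof -
  have "Inr ` y \<inter> A \<noteq> {} \<longleftrightarrow> y \<inter> Inr -` A \<noteq> {}" for y by auto
  then have "(\<forall>x. (x, Inr b) \<in> bundles (\<E> \<parallel>\<^sub>b \<F>) \<longrightarrow> x \<inter> A \<noteq> {}) \<longleftrightarrow>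
      (\<forall>y. (y, b) \<in> bundles \<F> \<longrightarrow> y \<inter> Inr -` A \<noteq> {})"
    unfolding par_simps by metis
  then show ?thesis unfolding enabled_def by (auto simp: par_simps)
qed

text \<open>No bundle or conflict links the two sides, so whether an event is enabled depends only
  on the earlier events of its own side.\<close>

lemma traces_par: "\<alpha> \<in> traces (\<E> \<parallel>\<^sub>b \<F>) \<longleftrightarrow> lefts \<alpha> \<in> traces \<E> \<and> rights \<alpha> \<in> traces \<F>"
proof (induction \<alpha> rule: rev_induct)
  case (snoc e \<alpha>)
  have "Inl -` set \<alpha> = set (lefts \<alpha>)" "Inr -` set \<alpha> = set (rights \<alpha>)"
    by (auto simp: set_lefts set_rights)
  with snoc show ?case
    by (cases e) (auto simp: traces_snoc enabled_par_Inl enabled_par_Inr)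
qed auto

section \<open>Sequential composition after an atomic action\<close>

lemma enabled_seq_Inl: "enabled (\<E> \<cdot>\<^sub>b \<F>) A (Inl a) \<longleftrightarrow> enabled \<E> (Inl -` A) a"
proof -
  have "enabled (\<E> \<cdot>\<^sub>b \<F>) A (Inl a) \<longleftrightarrow> enabled (\<E> \<parallel>\<^sub>b \<F>) A (Inl a)"
    by (auto simp: enabled_def seq_bes_def)
  then show ?thesis by (simp add: enabled_par_Inl)
qed

text \<open>The only exit set of \<open>atomic a\<close> is a singleton, so each added bundle is
  \<open>{Inl ()}\<close>. If \<open>\<F>\<close> is zero, the convention adds no bundle, but then
  there is no right event and both sides are false.\<close>

lemma enabled_atomic_seq_Inr:
  "enabled (atomic a \<cdot>\<^sub>b \<F>) A (Inr e) \<longleftrightarrow>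
     enabled \<F> (Inr -` A) e \<and> (e \<in> initial \<F> \<longrightarrow> Inl () \<in> A)"
proof (cases "is_zero \<F>")
  case True
  then show ?thesis by (auto simp: enabled_def is_zero_def seq_bes_def par_def)
next
  case False
  moreover have "\<not> is_zero (atomic a)" by (simp add: is_zero_def atomic_def)
  ultimately have *: "bundles (atomic a \<cdot>\<^sub>b \<F>) = bundles (atomic a \<parallel>\<^sub>b \<F>) \<union>
      {({Inl ()}, Inr e) |e. e \<in> initial \<F>}"
    "events (atomic a \<cdot>\<^sub>b \<F>) = events (atomic a \<parallel>\<^sub>b \<F>)"
    "conflict (atomic a \<cdot>\<^sub>b \<F>) = conflict (atomic a \<parallel>\<^sub>b \<F>)"
    by (auto simp: seq_bes_def) (auto simp: atomic_def)
  have "enabled (atomic a \<cdot>\<^sub>b \<F>) A (Inr e) \<longleftrightarrow>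
     enabled (atomic a \<parallel>\<^sub>b \<F>) A (Inr e) \<and> (e \<in> initial \<F> \<longrightarrow> Inl () \<in> A)"
    unfolding enabled_def * by auto
  then show ?thesis by (simp add: enabled_par_Inr)
qed

lemma enabled_atomic: "enabled (atomic a) A e \<longleftrightarrow> e \<notin> A"
  by (auto simp: enabled_def atomic_def)

lemma traces_atomic: "traces (atomic a) = {[], [()]}"
proof -
  have "\<alpha> \<in> traces (atomic a) \<Longrightarrow> \<alpha> = [] \<or> \<alpha> = [()]" for \<alpha>
    by (induction \<alpha> rule: rev_induct) (auto simp: traces_snoc enabled_atomic)
  moreover have "[()] \<in> traces (atomic a)"
    using traces_snoc[of "[]" "()" "atomic a"] by (simp add: enabled_atomic)
  ultimately show ?thesis by auto
qed

text \<open>An event of \<open>\<F>\<close> that is enabled without predecessors in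
  \<open>\<F>\<close> is initial there and hence waits for the action; after the action the new
  bundles are satisfied for good.\<close>

lemma traces_atomic_seq:
  "traces (atomic a \<cdot>\<^sub>b \<F>) = insert [] {Inl () # map Inr \<gamma> |\<gamma>. \<gamma> \<in> traces \<F>}"
proof (intro set_eqI iffI)
  fix \<alpha> assume "\<alpha> \<in> traces (atomic a \<cdot>\<^sub>b \<F>)"
  then show "\<alpha> \<in> insert [] {Inl () # map Inr \<gamma> |\<gamma>. \<gamma> \<in> traces \<F>}"
  proof (induction \<alpha> rule: rev_induct)
    case (snoc e \<alpha>)
    then have en: "enabled (atomic a \<cdot>\<^sub>b \<F>) (set \<alpha>) e"
      and IH: "\<alpha> = [] \<or> (\<exists>\<gamma>. \<alpha> = Inl () # map Inr \<gamma> \<and> \<gamma> \<in> traces \<F>)"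
      by (auto simp: traces_snoc)
    from IH show ?case
    proof (elim disjE exE conjE)
      assume \<alpha>: "\<alpha> = []"
      show ?thesis
      proof (cases e)
        case (Inr h)
        with en \<alpha> show ?thesis
          by (auto simp: enabled_atomic_seq_Inr[of _ _ "{}", simplified] enabled_empty[of \<F>])
      qed (use \<alpha> in \<open>auto intro!: exI[of _ "[]"]\<close>)
    next
      fix \<gamma> assume \<alpha>: "\<alpha> = Inl () # map Inr \<gamma>" and \<gamma>: "\<gamma> \<in> traces \<F>"
      show ?thesis
      proof (cases e)
        case (Inl u)
        with en \<alpha> show ?thesis by (simp add: enabled_seq_Inl enabled_atomic)
      next
        case (Inr h)
        with en \<alpha> have "enabled \<F> (Inr -` set (Inl () # map Inr \<gamma>)) h"
          by (auto simp: enabled_atomic_seq_Inr)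
        also have "Inr -` set (Inl () # map Inr \<gamma>) = set \<gamma>" by auto
        finally have "\<gamma> @ [h] \<in> traces \<F>" using \<gamma> by (simp add: traces_snoc)
        then show ?thesis using \<alpha> Inr by (auto intro!: exI[of _ "\<gamma> @ [h]"])
      qed
    qed
  qed auto
next
  fix \<alpha> assume "\<alpha> \<in> insert [] {Inl () # map Inr \<gamma> |\<gamma>. \<gamma> \<in> traces \<F>}"
  moreover have "Inl () # map Inr \<gamma> \<in> traces (atomic a \<cdot>\<^sub>b \<F>)" if "\<gamma> \<in> traces \<F>" for \<gamma>
    using that
  proof (induction \<gamma> rule: rev_induct)
    case Nil
    show ?case using traces_snoc[of "[]" "Inl ()" "atomic a \<cdot>\<^sub>b \<F>"]
      by (simp add: enabled_seq_Inl enabled_atomic)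
  next
    case (snoc h \<gamma>)
    have "Inr -` set (Inl () # map Inr \<gamma>) = set \<gamma>" by auto
    then have "enabled (atomic a \<cdot>\<^sub>b \<F>) (set (Inl () # map Inr \<gamma>)) (Inr h)"
      using snoc.prems by (simp add: enabled_atomic_seq_Inr traces_snoc)
    then show ?case
      using snoc traces_snoc[of "Inl () # map Inr \<gamma>" "Inr h" "atomic a \<cdot>\<^sub>b \<F>"]
      by (simp add: traces_snoc[of \<gamma>])
  qed
  ultimately show "\<alpha> \<in> traces (atomic a \<cdot>\<^sub>b \<F>)" by auto
qed

section \<open>Sums\<close>

lemma enabled_plus_homogeneous:
  "enabled (\<E> +\<^sub>b \<F>) (Inl ` A) (Inl e) \<longleftrightarrow> enabled \<E> A e"
  "enabled (\<E> +\<^sub>b \<F>) (Inr ` B) (Inr h) \<longleftrightarrow> enabled \<F> B h"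
proof -
  have "enabled (\<E> +\<^sub>b \<F>) (Inl ` A) (Inl e) \<longleftrightarrow> enabled (\<E> \<parallel>\<^sub>b \<F>) (Inl ` A) (Inl e)"
    "enabled (\<E> +\<^sub>b \<F>) (Inr ` B) (Inr h) \<longleftrightarrow> enabled (\<E> \<parallel>\<^sub>b \<F>) (Inr ` B) (Inr h)"
    by (auto simp: enabled_def plus_bes_def Let_def)
  then show "enabled (\<E> +\<^sub>b \<F>) (Inl ` A) (Inl e) \<longleftrightarrow> enabled \<E> A e"
    "enabled (\<E> +\<^sub>b \<F>) (Inr ` B) (Inr h) \<longleftrightarrow> enabled \<F> B h"
    by (simp_all add: enabled_par_Inl enabled_par_Inr inj_vimage_image_eq)
qed

lemma enabled_plusD: "enabled (\<E> +\<^sub>b \<F>) A e \<Longrightarrow> enabled (\<E> \<parallel>\<^sub>b \<F>) A e"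
  by (auto simp: enabled_def plus_bes_def Let_def split: if_splits)

lemma initials_conflict_plus:
  assumes "e \<in> initial \<E>" "h \<in> initial \<F>"
  shows "(Inl e, Inr h) \<in> conflict (\<E> +\<^sub>b \<F>)"
proof -
  have "\<not> is_zero \<E>" "\<not> is_zero \<F>"
    using assms by (auto simp: is_zero_def initial_def)
  with assms show ?thesis by (auto simp: plus_bes_def Let_def)
qed

text \<open>After left events only, a right event can be enabled only if it is initial, and then it
  conflicts with the initial event at the head of \<open>\<alpha>\<close>.\<close>

lemma enabled_plus_mixed:
  fixes \<F> :: "('f, 's) bes"
  assumes "\<alpha> \<in> traces \<E>" "\<alpha> \<noteq> []" shows "\<not> enabled (\<E> +\<^sub>b \<F>) (Inl ` set \<alpha>) (Inr h)"
proof
  assume en: "enabled (\<E> +\<^sub>b \<F>) (Inl ` set \<alpha>) (Inr h)"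
  have "Inr -` Inl ` set \<alpha> = ({} :: 'f set)" by auto
  then have "h \<in> initial \<F>"
    using enabled_plusD[OF en] by (simp add: enabled_par_Inr enabled_empty)
  then have "(Inl (hd \<alpha>), Inr h) \<in> conflict (\<E> +\<^sub>b \<F>)"
    using initial_in_hd[OF assms] initials_conflict_plus by metis
  then show False using en assms(2) by (auto simp: enabled_def)
qed

lemma enabled_plus_mixed':
  fixes \<E> :: "('e, 's) bes"
  assumes "\<beta> \<in> traces \<F>" "\<beta> \<noteq> []" shows "\<not> enabled (\<E> +\<^sub>b \<F>) (Inr ` set \<beta>) (Inl e)"
proof
  assume en: "enabled (\<E> +\<^sub>b \<F>) (Inr ` set \<beta>) (Inl e)"
  have "Inl -` Inr ` set \<beta> = ({} :: 'e set)" by auto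
  then have "e \<in> initial \<E>"
    using enabled_plusD[OF en] by (simp add: enabled_par_Inl enabled_empty)
  then have "(Inl e, Inr (hd \<beta>)) \<in> conflict (\<E> +\<^sub>b \<F>)"
    using initial_in_hd[OF assms] initials_conflict_plus by metis
  then show False using en assms(2) by (auto simp: enabled_def)
qed

text \<open>The first event decides the branch: the added conflicts never join two events of the
  same side, and they exclude any change of side.\<close>

lemma traces_plus: "traces (\<E> +\<^sub>b \<F>) = map Inl ` traces \<E> \<union> map Inr ` traces \<F>"
proof (intro set_eqI iffI)
  fix \<alpha> assume "\<alpha> \<in> traces (\<E> +\<^sub>b \<F>)"
  then show "\<alpha> \<in> map Inl ` traces \<E> \<union> map Inr ` traces \<F>"
  proof (induction \<alpha> rule: rev_induct)
    case (snoc e \<alpha>)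
    then have en: "enabled (\<E> +\<^sub>b \<F>) (set \<alpha>) e"
      and IH: "\<alpha> \<in> map Inl ` traces \<E> \<union> map Inr ` traces \<F>"
      by (auto simp: traces_snoc)
    have L: "map Inl (\<gamma> @ [h]) \<in> map Inl ` traces \<E>"
      if "\<gamma> \<in> traces \<E>" "\<alpha> = map Inl \<gamma>" "e = Inl h" for \<gamma> h
      using en that by (intro imageI) (simp add: traces_snoc enabled_plus_homogeneous)
    have R: "map Inr (\<gamma> @ [h]) \<in> map Inr ` traces \<F>"
      if "\<gamma> \<in> traces \<F>" "\<alpha> = map Inr \<gamma>" "e = Inr h" for \<gamma> h
      using en that by (intro imageI) (simp add: traces_snoc enabled_plus_homogeneous)
    show ?case
    proof (cases e)
      case (Inl h)
      show ?thesis
      proof (cases "\<exists>\<gamma>\<in>traces \<E>. \<alpha> = map Inl \<gamma>")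
        case True
        with Inl L show ?thesis by auto
      next
        case False
        with IH obtain \<gamma> where "\<gamma> \<in> traces \<F>" "\<alpha> = map Inr \<gamma>" "\<gamma> \<noteq> []" by force
        with Inl en enabled_plus_mixed'[of \<gamma> \<F> \<E> h] show ?thesis by simp
      qed
    next
      case (Inr h)
      show ?thesis
      proof (cases "\<exists>\<gamma>\<in>traces \<F>. \<alpha> = map Inr \<gamma>")
        case True
        with Inr R show ?thesis by auto
      next
        case False
        with IH obtain \<gamma> where "\<gamma> \<in> traces \<E>" "\<alpha> = map Inl \<gamma>" "\<gamma> \<noteq> []" by force
        with Inr en enabled_plus_mixed[of \<gamma> \<E> \<F> h] show ?thesis by simp
      qed
    qed
  qed (auto intro: image_eqI[of _ _ "[]"])
next
  fix \<alpha> assume "\<alpha> \<in> map Inl ` traces \<E> \<union> map Inr ` traces \<F>"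
  moreover have "map Inl \<gamma> \<in> traces (\<E> +\<^sub>b \<F>)" if "\<gamma> \<in> traces \<E>" for \<gamma>
    using that by (induction \<gamma> rule: rev_induct) (simp_all add: traces_snoc enabled_plus_homogeneous)
  moreover have "map Inr \<gamma> \<in> traces (\<E> +\<^sub>b \<F>)" if "\<gamma> \<in> traces \<F>" for \<gamma>
    using that by (induction \<gamma> rule: rev_induct) (simp_all add: traces_snoc enabled_plus_homogeneous)
  ultimately show "\<alpha> \<in> traces (\<E> +\<^sub>b \<F>)" by auto
qed

section \<open>Iterations of an atomic action\<close>

definition loops :: "nat \<Rightarrow> (nat \<times> (unit + 'h)) list" where
  "loops n = map (\<lambda>k. (k, Inl ())) [0..<n]"

lemma loops_simps [simp]:
  "loops 0 = []" "loops (Suc n) = loops n @ [(n, Inl ())]" "length (loops n) = n"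
  "set (loops n) = (\<lambda>k. (k, Inl ())) ` {..<n}"
  by (auto simp: loops_def)

lemma star_simps:
  "(j, Inl ()) \<in> events (atomic r \<star>\<^sub>b \<H>)"
  "(m, Inr h) \<in> events (atomic r \<star>\<^sub>b \<H>) \<longleftrightarrow> h \<in> events \<H>"
  "(d, (j, Inl ())) \<in> conflict (atomic r \<star>\<^sub>b \<H>) \<longleftrightarrow> (\<exists>h\<in>initial \<H>. d = (j, Inr h))"
  "((j, Inl ()), d) \<in> conflict (atomic r \<star>\<^sub>b \<H>) \<longleftrightarrow> (\<exists>h\<in>initial \<H>. d = (j, Inr h))"
  "((m, Inr h), (m, Inr h')) \<in> conflict (atomic r \<star>\<^sub>b \<H>) \<longleftrightarrow> (h, h') \<in> conflict \<H>"
  by (auto simp: star_bes_def Let_def par_def atomic_def initial_def)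

lemma star_bundle_loop:
  "(x, (j, Inl ())) \<in> bundles (atomic r \<star>\<^sub>b \<H>) \<longleftrightarrow> j \<noteq> 0 \<and> x = {(j - 1, Inl ())}"
  by (cases j) (auto simp: star_bes_def Let_def par_def atomic_def initial_def)

lemma star_bundle_exit:
  "(x, (m, Inr h)) \<in> bundles (atomic r \<star>\<^sub>b \<H>) \<longleftrightarrow>
     (\<exists>y. x = (\<lambda>h. (m, Inr h)) ` y \<and> (y, h) \<in> bundles \<H>) \<or>
     m \<noteq> 0 \<and> h \<in> initial \<H> \<and> x = {(m - 1, Inl ())}"
proof -
  have "(\<exists>y. x = Pair m ` y \<and> (y, Inr h) \<in> bundles (atomic r \<parallel>\<^sub>b \<H>)) \<longleftrightarrow>
      (\<exists>y. x = (\<lambda>h. (m, Inr h)) ` y \<and> (y, h) \<in> bundles \<H>)"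
    unfolding par_simps by (metis image_image)
  moreover have "(\<exists>k y. x = (\<lambda>e. (k, Inl e)) ` y \<and> m = Suc k \<and> y \<in> exits (atomic r) \<and>
        Inr h \<in> Inr ` initial \<H> \<union> Inl ` initial (atomic r)) \<longleftrightarrow>
      m \<noteq> 0 \<and> h \<in> initial \<H> \<and> x = {(m - 1, Inl ())}"
    by (cases m) (auto simp: atomic_def)
  moreover have "(x, (m, Inr h)) \<in> bundles (atomic r \<star>\<^sub>b \<H>) \<longleftrightarrow>
      (\<exists>y. x = Pair m ` y \<and> (y, Inr h) \<in> bundles (atomic r \<parallel>\<^sub>b \<H>)) \<or>
      (\<exists>k y. x = (\<lambda>e. (k, Inl e)) ` y \<and> m = Suc k \<and> y \<in> exits (atomic r) \<and>
        Inr h \<in> Inr ` initial \<H> \<union> Inl ` initial (atomic r))"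
    by (simp add: star_bes_def Let_def)
  ultimately show ?thesis by simp
qed

lemma enabled_star_loop:
  "enabled (atomic r \<star>\<^sub>b \<H>) A (j, Inl ()) \<longleftrightarrow>
     (j, Inl ()) \<notin> A \<and> (\<forall>h\<in>initial \<H>. (j, Inr h) \<notin> A) \<and> (j = 0 \<or> (j - 1, Inl ()) \<in> A)"
  unfolding enabled_def star_bundle_loop by (auto simp: star_simps)

lemma enabled_star_bundle:
  "(\<forall>x. (x, (m, Inr h)) \<in> bundles (atomic r \<star>\<^sub>b \<H>) \<longrightarrow> x \<inter> A \<noteq> {}) \<longleftrightarrow>
     (\<forall>y. (y, h) \<in> bundles \<H> \<longrightarrow> y \<inter> {h. (m, Inr h) \<in> A} \<noteq> {}) \<and>
     (m \<noteq> 0 \<and> h \<in> initial \<H> \<longrightarrow> (m - 1, Inl ()) \<in> A)"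
proof -
  have "(\<lambda>h. (m, Inr h)) ` y \<inter> A \<noteq> {} \<longleftrightarrow> y \<inter> {h. (m, Inr h) \<in> A} \<noteq> {}" for y by auto
  moreover have "{(m - 1, Inl ())} \<inter> A \<noteq> {} \<longleftrightarrow> (m - 1, Inl ()) \<in> A" by simp
  ultimately show ?thesis unfolding star_bundle_exit by metis
qed

text \<open>Only initial events of copy \<open>m\<close> are tied to the loops: they conflict with
  loop \<open>m\<close> and wait for loop \<open>m - 1\<close>.\<close>

lemma enabled_star_exitD:
  assumes "enabled (atomic r \<star>\<^sub>b \<H>) A (m, Inr h)"
  shows "enabled \<H> {h. (m, Inr h) \<in> A} h"
    and "h \<in> initial \<H> \<Longrightarrow> (m, Inl ()) \<notin> A \<and> (m = 0 \<or> (m - 1, Inl ()) \<in> A)"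
  using assms unfolding enabled_def enabled_star_bundle star_simps
  by (auto simp: star_simps)

lemma enabled_star_exitI:
  assumes "enabled \<H> B h"
  shows "enabled (atomic r \<star>\<^sub>b \<H>) ((\<lambda>k. (k, Inl ())) ` {..<n} \<union> (\<lambda>h. (n, Inr h)) ` B) (n, Inr h)"
proof -
  have "{h. (n, Inr h) \<in> (\<lambda>k. (k, Inl ())) ` {..<n} \<union> (\<lambda>h. (n, Inr h)) ` B} = B" by auto
  then show ?thesis
    using assms unfolding enabled_def enabled_star_bundle star_simps
    by (auto simp: star_simps)
qed

text \<open>Loops can only occur in order. Entering a copy requires an initial event of it, which
  conflicts with the next loop and so freezes the number of loops and with it the only copy that can
  be used.\<close>

lemma traces_star:
  "traces (atomic r \<star>\<^sub>b \<H>) = {loops n @ map (\<lambda>h. (n, Inr h)) \<eta> |n \<eta>. \<eta> \<in> traces \<H>}"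
proof (intro set_eqI iffI)
  fix \<alpha> assume "\<alpha> \<in> traces (atomic r \<star>\<^sub>b \<H>)"
  then show "\<alpha> \<in> {loops n @ map (\<lambda>h. (n, Inr h)) \<eta> |n \<eta>. \<eta> \<in> traces \<H>}"
  proof (induction \<alpha> rule: rev_induct)
    case (snoc e \<alpha>)
    then have en: "enabled (atomic r \<star>\<^sub>b \<H>) (set \<alpha>) e" by (auto simp: traces_snoc)
    from snoc obtain n \<eta> where \<alpha>: "\<alpha> = loops n @ map (\<lambda>h. (n, Inr h)) \<eta>" and \<eta>: "\<eta> \<in> traces \<H>"
      by (auto simp: traces_snoc)
    obtain m z where e: "e = (m, z)" by fastforce
    show ?case
    proof (cases z)
      case (Inl u)
      with en e \<alpha> have "m = n" by (auto simp: enabled_star_loop)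
      moreover from this en e Inl \<alpha> have "\<forall>h\<in>initial \<H>. h \<notin> set \<eta>"
        by (auto simp: enabled_star_loop)
      \<comment> \<open>A loop is enabled only while copy \<open>n\<close> has not been entered,
        since entering it takes an initial event.\<close>
      with initial_in_hd[OF \<eta>] have "\<eta> = []" by (metis hd_in_set)
      ultimately have "\<alpha> @ [e] = loops (Suc n) @ map (\<lambda>h. (Suc n, Inr h)) []"
        using e Inl \<alpha> by simp
      then show ?thesis using Nil_in_traces by blast
    next
      case (Inr h)
      note D = enabled_star_exitD[OF en[unfolded e Inr]]
      \<comment> \<open>An event of a fresh copy is initial there, so loop \<open>m - 1\<close> has
        occurred (or \<open>m\<close> is 0) and loop \<open>m\<close> has not; with exactly the
        loops below \<open>n\<close> present, this leaves \<open>m = n\<close>.\<close>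
      have "m = n"
      proof (rule ccontr)
        assume "m \<noteq> n"
        then have "{h. (m, Inr h) \<in> set \<alpha>} = {}" by (auto simp: \<alpha>)
        then have "h \<in> initial \<H>" using D(1) by (simp add: enabled_empty)
        then show False using D(2) \<open>m \<noteq> n\<close> by (auto simp: \<alpha>)
      qed
      moreover have "{h. (n, Inr h) \<in> set \<alpha>} = set \<eta>" by (auto simp: \<alpha>)
      ultimately have "\<eta> @ [h] \<in> traces \<H>" using D(1) \<eta> by (simp add: traces_snoc)
      moreover have "\<alpha> @ [e] = loops n @ map (\<lambda>h. (n, Inr h)) (\<eta> @ [h])"
        using \<open>m = n\<close> by (simp add: \<alpha> e Inr)
      ultimately show ?thesis by blast
    qed
  qed (auto intro!: exI[of _ 0] exI[of _ "[]"])
next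
  have loops: "loops n \<in> traces (atomic r \<star>\<^sub>b \<H>)" for n
    by (induction n) (auto simp: traces_snoc enabled_star_loop)
  have "loops n @ map (\<lambda>h. (n, Inr h)) \<eta> \<in> traces (atomic r \<star>\<^sub>b \<H>)" if "\<eta> \<in> traces \<H>" for n \<eta>
    using that
  proof (induction \<eta> rule: rev_induct)
    case (snoc h \<eta>)
    then show ?case
      using traces_snoc[of "loops n @ map (\<lambda>h. (n, Inr h)) \<eta>" "(n, Inr h)" "atomic r \<star>\<^sub>b \<H>"]
      by (simp add: traces_snoc enabled_star_exitI)
  qed (simp add: loops)
  then show "\<alpha> \<in> traces (atomic r \<star>\<^sub>b \<H>)"
    if "\<alpha> \<in> {loops n @ map (\<lambda>h. (n, Inr h)) \<eta> |n \<eta>. \<eta> \<in> traces \<H>}" for \<alpha>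
    using that by auto
qed

lemma traces_iter:
  "u \<in> traces (iter r) \<longleftrightarrow> (\<exists>n. u = loops n \<or> u = loops n @ [(n, Inr ())])"
proof -
  have "u \<in> traces (iter r) \<longleftrightarrow> (\<exists>n \<eta>. u = loops n @ map (\<lambda>h. (n, Inr h)) \<eta> \<and> (\<eta> = [] \<or> \<eta> = [()]))"
    unfolding iter_def traces_star one_def traces_atomic by simp
  also have "\<dots> \<longleftrightarrow> (\<exists>n. u = loops n \<or> u = loops n @ [(n, Inr ())])" by force
  finally show ?thesis .
qed


lemma loops_eq_iff [simp]: "loops m = loops n \<longleftrightarrow> m = n"
  by (metis loops_simps(3))

lemma loops_snoc_neq [simp]: "loops m @ [(k, Inr h)] \<noteq> loops n"
proof
  assume eq: "loops m @ [(k, Inr h)] = loops n"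
  have "(k, Inr h) \<in> set (loops m @ [(k, Inr h)])" by simp
  then show False unfolding eq by auto
qed

text \<open>Both the loop and the exit of round \<open>k\<close> come directly after the loops below
  \<open>k\<close>, so the index of the last event determines the whole past.\<close>

lemma iter_snoc: "u @ [(k, z)] \<in> traces (iter r) \<longleftrightarrow> u = loops k"
proof
  assume "u @ [(k, z)] \<in> traces (iter r)"
  then obtain n where "u @ [(k, z)] = loops n \<or> u @ [(k, z)] = loops n @ [(n, Inr ())]"
    by (auto simp: traces_iter)
  then show "u = loops k" by (cases n) auto
next
  assume u: "u = loops k"
  show "u @ [(k, z)] \<in> traces (iter r)"
    unfolding traces_iter by (cases z) (auto simp: u intro: exI[of _ "Suc k"] exI[of _ k])
qed

text \<open>By \<open>iter_snoc\<close> the past of any event consists of loops, so nothing follows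
  an exit.\<close>

lemma iter_exited:
  assumes "u @ w \<in> traces (iter r)" "(j, Inr ()) \<in> set u"
  shows "w = []"
proof (cases w rule: rev_cases)
  case (snoc w' x)
  then have "u @ w' = loops (fst x)"
    using assms(1) iter_snoc[of "u @ w'" "fst x" "snd x" r] by simp
  then have "(j, Inr ()) \<in> set (loops (fst x))"
    using assms(2) by (metis UnCI set_append)
  then show ?thesis by auto
qed

definition loop_count :: "(nat \<times> (unit + unit)) list \<Rightarrow> nat" where
  "loop_count u = length (filter (\<lambda>x. isl (snd x)) u)"

lemma loop_count_simps [simp]:
  "loop_count [] = 0" "loop_count (u @ v) = loop_count u + loop_count v"
  "loop_count [(k, Inl a)] = 1" "loop_count [(k, Inr a)] = 0" "loop_count (loops n) = n"
proof -
  show "loop_count (loops n) = n" by (induction n) (auto simp: loop_count_def)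
qed (auto simp: loop_count_def)

text \<open>At most one event is an exit, and the exit carries the number of loops as its index.
  These bounds yield the finiteness of the preimages.\<close>

lemma loop_count_bounds:
  assumes "u \<in> traces (iter r)"
  shows "length u \<le> Suc (loop_count u)" "(k, z) \<in> set u \<Longrightarrow> k \<le> loop_count u"
  using assms unfolding traces_iter by auto

lemma takeWhile_loops:
  "takeWhile (\<lambda>x. isl (snd x)) (loops n @ (n, Inr h) # w) = loops n"
  by (subst takeWhile_append2) auto

text \<open>Once copy \<open>n\<close> has been entered, any continuation stays in it and continues
  a trace of \<open>\<H>\<close>; maximality in the star thereby reduces to maximality in
  \<open>\<H>\<close>.\<close>

lemma star_trace_extension:
  fixes \<H> :: "('h, 's::finite) bes"
  assumes "loops n @ map (\<lambda>h. (n, Inr h)) \<eta> @ w \<in> traces (atomic r \<star>\<^sub>b \<H>)" "\<eta> \<noteq> []"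
  obtains \<zeta> where "\<eta> @ \<zeta> \<in> traces \<H>" "w = map (\<lambda>h. (n, Inr h)) \<zeta>"
proof -
  obtain m \<theta> where eq: "loops n @ map (\<lambda>h. (n, Inr h)) \<eta> @ w = loops m @ map (\<lambda>h. (m, Inr h)) \<theta>"
    and \<theta>: "\<theta> \<in> traces \<H>"
    using assms(1) unfolding traces_star by blast
  obtain h \<eta>' where \<eta>: "\<eta> = h # \<eta>'" using assms(2) by (cases \<eta>) auto
  have "\<theta> \<noteq> []"
  proof
    assume "\<theta> = []"
    moreover have "(n, Inr h) \<in> set (loops n @ map (\<lambda>h. (n, Inr h)) \<eta> @ w)"
      by (simp add: \<eta>)
    ultimately show False unfolding eq by auto
  qed
  then obtain h' \<theta>' where \<theta>': "\<theta> = h' # \<theta>'" by (cases \<theta>) auto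
  \<comment> \<open>The number of loops is read off as the longest prefix of loop events; this is
    why both \<open>\<eta>\<close> and \<open>\<theta>\<close> have to be non-empty.\<close>
  have "loops n = (loops m :: (nat \<times> (unit + _)) list)"
    using arg_cong[OF eq, of "takeWhile (\<lambda>x. isl (snd x))"]
    by (simp add: \<eta> \<theta>' takeWhile_loops)
  then have "n = m" by simp
  with eq have eq': "map (\<lambda>h. (n, Inr h)) \<eta> @ w = map (\<lambda>h. (n, Inr h)) \<theta>" by simp
  have "inj (\<lambda>h. (n, Inr h :: unit + 'h))" by (auto simp: inj_on_def)
  then have "\<eta> = take (length \<eta>) \<theta>"
    using arg_cong[OF eq', of "take (length \<eta>)"]
    by (simp add: take_map inj_map_eq_map)
  then have "\<eta> @ drop (length \<eta>) \<theta> = \<theta>" by (metis append_take_drop_id)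
  moreover have "w = map (\<lambda>h. (n, Inr h)) (drop (length \<eta>) \<theta>)"
    using arg_cong[OF eq', of "drop (length \<eta>)"] by (simp add: drop_map)
  ultimately show thesis using that \<theta> by metis
qed

section \<open>Labels and maximal traces\<close>

lemma label_star [simp]:
  "label (atomic r \<star>\<^sub>b \<H>) (k, Inl a) = r" "label (atomic r \<star>\<^sub>b \<H>) (k, Inr h) = label \<H> h"
  by (auto simp: star_bes_def Let_def par_def atomic_def)

lemma label_atomic [simp]: "label (atomic a) e = a"
  by (simp add: atomic_def)

lemma label_par [simp]: "label (\<E> \<parallel>\<^sub>b \<F>) = case_sum (label \<E>) (label \<F>)"
  by (simp add: par_def)

lemma label_seq [simp]: "label (\<E> \<cdot>\<^sub>b \<F>) = case_sum (label \<E>) (label \<F>)"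
  by (simp add: seq_bes_def)

lemma label_plus [simp]: "label (\<E> +\<^sub>b \<F>) = case_sum (label \<E>) (label \<F>)"
  by (simp add: plus_bes_def Let_def)

lemma label_iter [simp]: "label (iter r) (k, Inl a) = r" "label (iter r) (k, Inr a) = skip"
  by (simp_all add: iter_def one_def)

lemma prog_le_refl [simp]: "r \<sqsubseteq>\<^sub>H r"
  by (simp add: prog_le_def)

lemma trace_events: "\<alpha> @ [e] \<in> traces \<E> \<Longrightarrow> e \<in> events \<E>"
  by (simp add: traces_snoc enabled_def)

lemma max_tracesD: "\<alpha> \<in> max_traces \<E> \<Longrightarrow> \<alpha> \<in> traces \<E>" "\<alpha> \<in> max_traces \<E> \<Longrightarrow> \<alpha> @ \<beta> \<in> traces \<E> \<Longrightarrow> \<beta> = []"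
  by (auto simp: max_traces_def)

lemma max_tracesI:
  assumes "\<alpha> \<in> traces \<E>" "\<And>\<beta>. \<alpha> @ \<beta> \<in> traces \<E> \<Longrightarrow> \<beta> = []"
  shows "\<alpha> \<in> max_traces \<E>"
  using assms by (auto simp: max_traces_def prefix_def)

lemma iter_max_trace: "loops n @ [(n, Inr ())] \<in> max_traces (iter r)"
proof (rule max_tracesI)
  fix \<beta> assume "(loops n @ [(n, Inr ())]) @ \<beta> \<in> traces (iter r)"
  then show "\<beta> = []" by (rule iter_exited[where j = n]) simp
qed (simp add: iter_snoc)

section \<open>Parallel composition of two iterations\<close>

definition merge_iter ::
  "(nat \<times> (unit + unit) + nat \<times> (unit + unit)) list \<Rightarrow> (nat \<times> (unit + unit)) list" where
  "merge_iter \<alpha> = (let m = loop_count (lefts \<alpha>) + loop_count (rights \<alpha>) in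
     loops m @ (if (\<exists>j. (j, Inr ()) \<in> set (lefts \<alpha>)) \<and> (\<exists>j. (j, Inr ()) \<in> set (rights \<alpha>))
       then [(m, Inr ())] else []))"

lemma merge_iter_step:
  assumes "\<alpha> @ [e] \<in> traces (iter r \<parallel>\<^sub>b iter r)"
  shows "merge_iter (\<alpha> @ [e]) = merge_iter \<alpha> \<and> label (iter r \<parallel>\<^sub>b iter r) e = skip \<or>
    (\<exists>e'. label (iter r \<parallel>\<^sub>b iter r) e = label (iter r) e' \<and>
       merge_iter (\<alpha> @ [e]) = merge_iter \<alpha> @ [e'])"
proof (cases e)
  case (Inl x)
  obtain k z where x: "x = (k, z)" by fastforce
  \<comment> \<open>A side that still moves has not exited, so the image built so far consists of
    loops only and can be extended.\<close>
  have l: "lefts \<alpha> = loops k"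
    using assms Inl x by (simp add: traces_par iter_snoc)
  let ?m = "k + loop_count (rights \<alpha>)"
  show ?thesis
  proof (cases z)
    case (Inl u)
    then have "label (iter r \<parallel>\<^sub>b iter r) e = label (iter r) (?m, Inl ())"
      "merge_iter (\<alpha> @ [e]) = merge_iter \<alpha> @ [(?m, Inl ())]"
      using l x \<open>e = Inl x\<close> by (auto simp: merge_iter_def Let_def)
    then show ?thesis by blast
  next
    case (Inr u)
    then have "label (iter r \<parallel>\<^sub>b iter r) e = label (iter r) (?m, Inr ())"
      "label (iter r \<parallel>\<^sub>b iter r) e = skip"
      "merge_iter (\<alpha> @ [e]) = merge_iter \<alpha> \<or> merge_iter (\<alpha> @ [e]) = merge_iter \<alpha> @ [(?m, Inr ())]"
      using l x \<open>e = Inl x\<close> by (auto simp: merge_iter_def Let_def)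
    then show ?thesis by blast
  qed
next
  case (Inr x)
  obtain k z where x: "x = (k, z)" by fastforce
  have l: "rights \<alpha> = loops k"
    using assms Inr x by (simp add: traces_par iter_snoc)
  let ?m = "loop_count (lefts \<alpha>) + k"
  show ?thesis
  proof (cases z)
    case (Inl u)
    then have "label (iter r \<parallel>\<^sub>b iter r) e = label (iter r) (?m, Inl ())"
      "merge_iter (\<alpha> @ [e]) = merge_iter \<alpha> @ [(?m, Inl ())]"
      using l x \<open>e = Inr x\<close> by (auto simp: merge_iter_def Let_def)
    then show ?thesis by blast
  next
    case (Inr u)
    then have "label (iter r \<parallel>\<^sub>b iter r) e = label (iter r) (?m, Inr ())"
      "label (iter r \<parallel>\<^sub>b iter r) e = skip"
      "merge_iter (\<alpha> @ [e]) = merge_iter \<alpha> \<or> merge_iter (\<alpha> @ [e]) = merge_iter \<alpha> @ [(?m, Inr ())]"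
      using l x \<open>e = Inr x\<close> by (auto simp: merge_iter_def Let_def)
    then show ?thesis by blast
  qed
qed

lemma merge_iter_trace: "merge_iter \<alpha> \<in> traces (iter r)"
  unfolding merge_iter_def Let_def traces_iter by auto

text \<open>An iteration that has not exited can always exit, whatever the other side has
  done.\<close>

lemma max_par_iter_exited:
  assumes "\<alpha> \<in> max_traces (iter r \<parallel>\<^sub>b \<G>)"
  obtains k where "lefts \<alpha> = loops k @ [(k, Inr ())]"
proof -
  have "lefts \<alpha> \<in> traces (iter r)" "rights \<alpha> \<in> traces \<G>"
    using max_tracesD(1)[OF assms] by (auto simp: traces_par)
  moreover have False if "lefts \<alpha> = loops k" for k
  proof -
    have "\<alpha> @ [Inl (k, Inr ())] \<in> traces (iter r \<parallel>\<^sub>b \<G>)"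
      using that \<open>rights \<alpha> \<in> traces \<G>\<close> by (simp add: traces_par iter_snoc)
    from max_tracesD(2)[OF assms this] show False by simp
  qed
  ultimately show thesis using that by (auto simp: traces_iter)
qed

lemma max_par_iter_exited':
  assumes "\<alpha> \<in> max_traces (\<G> \<parallel>\<^sub>b iter r)"
  obtains k where "rights \<alpha> = loops k @ [(k, Inr ())]"
proof -
  have "rights \<alpha> \<in> traces (iter r)" "lefts \<alpha> \<in> traces \<G>"
    using max_tracesD(1)[OF assms] by (auto simp: traces_par)
  moreover have False if "rights \<alpha> = loops k" for k
  proof -
    have "\<alpha> @ [Inr (k, Inr ())] \<in> traces (\<G> \<parallel>\<^sub>b iter r)"
      using that \<open>lefts \<alpha> \<in> traces \<G>\<close> by (simp add: traces_par iter_snoc)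
    from max_tracesD(2)[OF assms this] show False by simp
  qed
  ultimately show thesis using that by (auto simp: traces_iter)
qed

lemma sim_iter_par_iter: "(iter r \<parallel>\<^sub>b iter r) \<sqsubseteq>\<^sub>s\<^sub>i\<^sub>m iter r"
  unfolding sim_def t_simulation_def
proof (intro exI[of _ merge_iter] conjI ballI allI impI)
  show "merge_iter \<alpha> \<in> traces (iter r)" for \<alpha> by (rule merge_iter_trace)
  show "merge_iter [] = []" by (simp add: merge_iter_def)
  fix \<beta> :: "(nat \<times> (unit + unit)) list"
  \<comment> \<open>Every index is at most the total number of loops, hence at most the length of
    the image; the \<open>+ 2\<close> below accounts for the exits of the two sides.\<close>
  let ?A = "{..length \<beta>} \<times> UNIV :: (nat \<times> (unit + unit)) set"
  show "finite {\<alpha> \<in> traces (iter r \<parallel>\<^sub>b iter r). merge_iter \<alpha> = \<beta>}"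
  proof (rule finite_subset)
    show "finite {\<alpha>. set \<alpha> \<subseteq> Inl ` ?A \<union> Inr ` ?A \<and> length \<alpha> \<le> length \<beta> + 2}"
      by (intro finite_lists_length_le) auto
    show "{\<alpha> \<in> traces (iter r \<parallel>\<^sub>b iter r). merge_iter \<alpha> = \<beta>} \<subseteq> \<dots>"
    proof clarify
      fix \<alpha> assume "\<alpha> \<in> traces (iter r \<parallel>\<^sub>b iter r)"
      then have t: "lefts \<alpha> \<in> traces (iter r)" "rights \<alpha> \<in> traces (iter r)"
        by (auto simp: traces_par)
      have m: "loop_count (lefts \<alpha>) + loop_count (rights \<alpha>) \<le> length (merge_iter \<alpha>)"
        by (simp add: merge_iter_def Let_def)
      have "e \<in> Inl ` ({..length (merge_iter \<alpha>)} \<times> UNIV) \<union> Inr ` ({..length (merge_iter \<alpha>)} \<times> UNIV)"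
        if "e \<in> set \<alpha>" for e
      proof (cases e)
        case (Inl x)
        then have "fst x \<le> loop_count (lefts \<alpha>)"
          using that loop_count_bounds(2)[OF t(1), of "fst x" "snd x"] by (simp add: set_lefts)
        then show ?thesis using Inl m by (cases x) auto
      next
        case (Inr x)
        then have "fst x \<le> loop_count (rights \<alpha>)"
          using that loop_count_bounds(2)[OF t(2), of "fst x" "snd x"] by (simp add: set_rights)
        then show ?thesis using Inr m by (cases x) auto
      qed
      moreover have "length \<alpha> \<le> length (merge_iter \<alpha>) + 2"
        using loop_count_bounds(1)[OF t(1)] loop_count_bounds(1)[OF t(2)] m
        by (simp add: length_lefts_rights[of \<alpha>])
      ultimately show "set \<alpha> \<subseteq> Inl ` ({..length (merge_iter \<alpha>)} \<times> UNIV) \<union>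
            Inr ` ({..length (merge_iter \<alpha>)} \<times> UNIV) \<and> length \<alpha> \<le> length (merge_iter \<alpha>) + 2"
        by blast
    qed
  qed
next
  fix \<alpha> e assume "\<alpha> @ [e] \<in> traces (iter r \<parallel>\<^sub>b iter r)"
  from merge_iter_step[OF this]
  show "(merge_iter (\<alpha> @ [e]) = merge_iter \<alpha> \<and> label (iter r \<parallel>\<^sub>b iter r) e \<sqsubseteq>\<^sub>H skip) \<or>
      (\<exists>e'\<in>events (iter r). label (iter r \<parallel>\<^sub>b iter r) e \<sqsubseteq>\<^sub>H label (iter r) e' \<and>
         merge_iter (\<alpha> @ [e]) = merge_iter \<alpha> @ [e'])"
    using merge_iter_trace trace_events by (metis prog_le_refl)
next
  fix \<alpha> e assume max: "\<alpha> @ [e] \<in> max_traces (iter r \<parallel>\<^sub>b iter r)"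
  obtain k l where k: "lefts (\<alpha> @ [e]) = loops k @ [(k, Inr ())]"
    and l: "rights (\<alpha> @ [e]) = loops l @ [(l, Inr ())]"
    using max_par_iter_exited[OF max] max_par_iter_exited'[OF max] by metis
  have eq: "merge_iter (\<alpha> @ [e]) = loops (k + l) @ [(k + l, Inr ())]"
    unfolding merge_iter_def k l by (auto simp: Let_def)
  then show "weakly_maximal (iter r) (merge_iter (\<alpha> @ [e]))"
    using iter_max_trace max_tracesD(1) by (fastforce simp: weakly_maximal_def)
  \<comment> \<open>The last event is the second exit: without it one side is still open, and the
    image has no exit event yet.\<close>
  have "merge_iter (\<alpha> @ [e]) \<noteq> merge_iter \<alpha>"
  proof (cases e)
    case (Inl x)
    with k have "lefts \<alpha> = loops k" by simp
    then show ?thesis unfolding eq by (auto simp: merge_iter_def Let_def)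
  next
    case (Inr x)
    with l have "rights \<alpha> = loops l" by simp
    then show ?thesis unfolding eq by (auto simp: merge_iter_def Let_def)
  qed
  then show "\<exists>e'\<in>events (iter r). label (iter r \<parallel>\<^sub>b iter r) e \<sqsubseteq>\<^sub>H label (iter r) e' \<and>
         merge_iter (\<alpha> @ [e]) = merge_iter \<alpha> @ [e']"
    using merge_iter_step[OF max_tracesD(1)[OF max]] merge_iter_trace trace_events
    by (metis prog_le_refl)
qed

section \<open>Parallel composition of an iteration and a guarded choice\<close>

text \<open>The iteration inside a copy counts from 0, whereas the original one has already made
  \<open>n\<close> rounds when the guard occurs.\<close>

definition shift :: "nat \<Rightarrow> nat \<times> 'a \<Rightarrow> nat \<times> 'a" where
  "shift n = map_prod (\<lambda>k. k - n) id"

lemma map_shift_loops: "map (shift n) (drop n (loops k)) = loops (k - n)"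
  by (rule nth_equalityI) (auto simp: shift_def loops_def)

text \<open>If \<open>w\<close> is non-empty, then \<open>u\<close> contains no exit, so
  \<open>loop_count u\<close> is the length of \<open>u\<close> and \<open>w\<close> starts at
  exactly that round. If \<open>u\<close> has already exited, \<open>w\<close> is empty and nothing
  has to be renumbered.\<close>

lemma shift_iter_trace:
  assumes "u @ w \<in> traces (iter r)"
  shows "map (shift (loop_count u)) w \<in> traces (iter r)"
proof (cases w rule: rev_cases)
  case (snoc v x)
  obtain k z where x: "x = (k, z)" by fastforce
  from assms snoc x have uv: "u @ v = loops k"
    using iter_snoc[of "u @ v" k z r] by simp
  have "isl (snd y)" if "y \<in> set (u @ v)" for y
    using that unfolding uv by auto
  then have "filter (\<lambda>y. isl (snd y)) u = u" by (intro filter_True) auto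
  then have "loop_count u = length u" by (simp add: loop_count_def)
  moreover have "v = drop (length u) (loops k)" by (simp flip: uv)
  ultimately show ?thesis
    using map_shift_loops[of "length u" k] by (simp add: snoc x shift_def iter_snoc)
qed simp

text \<open>\<open>\<Gamma>\<close> collects the guards, \<open>res g\<close> the continuations
  after guard \<open>g\<close>; \<open>\<phi>\<close> embeds the events of \<open>\<G>\<close> into
  a copy, and \<open>\<rho> g\<close> embeds the iteration restarted after \<open>g\<close>. The
  latter depends on the guard because the branches of a sum contain different iterations.
  Injectivity makes the image decodable, both for maximality and for finiteness;
  \<open>guards\<close> and \<open>Nil_res\<close> ensure that a trace without guard can be extended
  by one.\<close>

locale guarded_choice =
  fixes r :: "'s::finite prog" and \<G> :: "('g, 's) bes" and \<H> :: "('h, 's) bes"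
    and \<Gamma> :: "'g set" and res :: "'g \<Rightarrow> 'g list set"
    and \<phi> :: "'g \<Rightarrow> 'h" and \<rho> :: "'g \<Rightarrow> nat \<times> (unit + unit) \<Rightarrow> 'h"
  assumes traces_\<G>: "traces \<G> = insert [] {g # \<gamma> |g \<gamma>. g \<in> \<Gamma> \<and> \<gamma> \<in> res g}"
    and traces_\<H>: "traces \<H> = insert [] {\<phi> g # map (case_sum (\<rho> g) \<phi>) \<delta> |g \<delta>.
      g \<in> \<Gamma> \<and> lefts \<delta> \<in> traces (iter r) \<and> rights \<delta> \<in> res g}"
    and guards: "\<Gamma> \<noteq> {}" and Nil_res: "g \<in> \<Gamma> \<Longrightarrow> [] \<in> res g"
    and inj: "inj (case_sum (\<rho> g) \<phi>)"
    and label_\<phi>: "label \<H> (\<phi> e) = label \<G> e"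
    and label_\<rho>: "label \<H> (\<rho> g x) = label (iter r) x"
begin

abbreviation "lhs \<equiv> iter r \<parallel>\<^sub>b \<G>"
abbreviation "rhs \<equiv> atomic r \<star>\<^sub>b \<H>"

definition relocate :: "nat \<Rightarrow> 'g \<Rightarrow> nat \<times> (unit + unit) + 'g \<Rightarrow> 'h" where
  "relocate n g = case_sum (\<rho> g) \<phi> \<circ> map_sum (shift n) id"

text \<open>The default equation serves the case that no guard has occurred: after
  \<open>dropWhile isl\<close> a non-empty list starts with \<open>Inr\<close>.\<close>

fun body :: "nat \<Rightarrow> (nat \<times> (unit + unit) + 'g) list \<Rightarrow> 'h list" where
  "body n (Inr g # \<delta>) = \<phi> g # map (relocate n g) \<delta>"
| "body n _ = []"

definition simulate :: "(nat \<times> (unit + unit) + 'g) list \<Rightarrow> (nat \<times> (unit + 'h)) list" where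
  "simulate \<alpha> = (let n = loop_count (lefts (takeWhile isl \<alpha>))
     in loops n @ map (\<lambda>h. (n, Inr h)) (body n (dropWhile isl \<alpha>)))"

lemma simulate_unguarded: "simulate (map Inl u) = loops (loop_count u)"
proof -
  have *: "takeWhile isl (map Inl u :: (nat \<times> (unit + unit) + 'g) list) = map Inl u"
    "dropWhile isl (map Inl u :: (nat \<times> (unit + unit) + 'g) list) = []"
    by auto
  show ?thesis unfolding simulate_def Let_def * by simp
qed

lemma simulate_guarded:
  "simulate (map Inl u @ Inr g # \<delta>) =
     loops (loop_count u) @ map (\<lambda>h. (loop_count u, Inr h)) (\<phi> g # map (relocate (loop_count u) g) \<delta>)"
proof -
  have "takeWhile isl (map Inl u @ Inr g # \<delta>) = map Inl u"
    "dropWhile isl (map Inl u @ Inr g # \<delta>) = Inr g # \<delta>"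
    by (auto simp: takeWhile_append dropWhile_append)
  then show ?thesis by (simp add: simulate_def Let_def)
qed

lemma guard_cases:
  fixes \<alpha> :: "(nat \<times> (unit + unit) + 'g) list"
  obtains u where "\<alpha> = map Inl u" | u g \<delta> where "\<alpha> = map Inl u @ Inr g # \<delta>"
proof -
  have "(\<exists>u. \<alpha> = map Inl u) \<or> (\<exists>u g \<delta>. \<alpha> = map Inl u @ Inr g # \<delta>)"
  proof (induction \<alpha>)
    case (Cons x \<alpha>)
    show ?case
    proof (cases x)
      case (Inl y)
      from Cons.IH show ?thesis
      proof (elim disjE exE)
        fix u assume "\<alpha> = map Inl u"
        with Inl show ?thesis by (intro disjI1 exI[of _ "y # u"]) simp
      next
        fix u g \<delta> assume "\<alpha> = map Inl u @ Inr g # \<delta>"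
        with Inl show ?thesis by (intro disjI2 exI[of _ "y # u"] exI[of _ g] exI[of _ \<delta>]) simp
      qed
    next
      case (Inr g)
      then show ?thesis by (intro disjI2 exI[of _ "[]"] exI[of _ g] exI[of _ \<alpha>]) simp
    qed
  qed simp
  with that show thesis by blast
qed

lemma unguarded_trace: "map Inl u \<in> traces lhs \<longleftrightarrow> u \<in> traces (iter r)"
  by (simp add: traces_par)

lemma guarded_trace: "map Inl u @ Inr g # \<delta> \<in> traces lhs \<longleftrightarrow>
    u @ lefts \<delta> \<in> traces (iter r) \<and> g \<in> \<Gamma> \<and> rights \<delta> \<in> res g"
  by (simp add: traces_par traces_\<G>)

lemma simulate_trace:
  assumes "\<alpha> \<in> traces lhs"
  shows "simulate \<alpha> \<in> traces rhs"
proof (cases \<alpha> rule: guard_cases)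
  case (1 u)
  have "loops (loop_count u) @ map (\<lambda>h. (loop_count u, Inr h)) [] \<in> traces rhs"
    unfolding traces_star using Nil_in_traces by blast
  then show ?thesis using 1 by (simp add: simulate_unguarded)
next
  case (2 u g \<delta>)
  let ?n = "loop_count u"
  let ?\<delta> = "map (map_sum (shift ?n) id) \<delta>"
  have "lefts ?\<delta> \<in> traces (iter r)" "rights ?\<delta> \<in> res g" "g \<in> \<Gamma>"
    using assms shift_iter_trace unfolding 2 guarded_trace by auto
  then have "\<phi> g # map (case_sum (\<rho> g) \<phi>) ?\<delta> \<in> traces \<H>" unfolding traces_\<H> by blast
  moreover have "simulate \<alpha> =
      loops ?n @ map (\<lambda>h. (?n, Inr h)) (\<phi> g # map (case_sum (\<rho> g) \<phi>) ?\<delta>)"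
    by (simp add: 2 simulate_guarded relocate_def)
  ultimately show ?thesis unfolding traces_star by blast
qed

lemma label_relocate: "label \<H> (relocate n g e) = label lhs e"
proof (cases e)
  case (Inl x)
  then show ?thesis
    by (cases x; cases "snd x") (auto simp: relocate_def shift_def label_\<rho>)
qed (simp add: relocate_def label_\<phi>)

text \<open>From the guard on every event is kept. As maximal traces contain a guard, this also
  settles the stricter requirement on their last event.\<close>

lemma simulate_step_guarded:
  assumes "\<alpha> @ [e] = map Inl u @ Inr g # \<delta>"
  shows "\<exists>e'. label lhs e = label rhs e' \<and> simulate (\<alpha> @ [e]) = simulate \<alpha> @ [e']"
proof (cases \<delta> rule: rev_cases)
  case Nil
  with assms have "\<alpha> = map Inl u" "e = Inr g" by auto
  then show ?thesis
    using simulate_guarded[of u g "[]"] by (simp add: simulate_unguarded label_\<phi>)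
next
  case (snoc \<delta>' x)
  with assms have \<alpha>: "\<alpha> = map Inl u @ Inr g # \<delta>'" "e = x" by auto
  let ?e' = "(loop_count u, Inr (relocate (loop_count u) g e))"
  have "simulate (\<alpha> @ [e]) = simulate \<alpha> @ [?e']"
    unfolding assms snoc unfolding \<alpha> simulate_guarded by simp
  moreover have "label lhs e = label rhs ?e'" by (simp only: label_star label_relocate)
  ultimately show ?thesis by blast
qed

lemma simulate_step:
  assumes "\<alpha> @ [e] \<in> traces lhs"
  shows "simulate (\<alpha> @ [e]) = simulate \<alpha> \<and> label lhs e = skip \<or>
    (\<exists>e'. label lhs e = label rhs e' \<and> simulate (\<alpha> @ [e]) = simulate \<alpha> @ [e'])"
proof (cases "\<alpha> @ [e]" rule: guard_cases)
  case (1 u)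
  then obtain v x where v: "\<alpha> = map Inl v" "e = Inl x" "u = v @ [x]"
    by (cases u rule: rev_cases) auto
  obtain k z where x: "x = (k, z)" by fastforce
  show ?thesis
  proof (cases z)
    case (Inl a)
    have "simulate (\<alpha> @ [e]) = simulate \<alpha> @ [(loop_count v, Inl ())]"
      unfolding 1 unfolding v simulate_unguarded by (simp add: x Inl)
    moreover have "label lhs e = label rhs (loop_count v, Inl ())" by (simp add: v x Inl)
    ultimately show ?thesis by blast
  next
    case (Inr a)
    have "simulate (\<alpha> @ [e]) = simulate \<alpha>"
      unfolding 1 unfolding v simulate_unguarded by (simp add: x Inr)
    then show ?thesis by (simp add: v x Inr)
  qed
next
  case (2 u g \<delta>)
  then show ?thesis using simulate_step_guarded by blast
qed

text \<open>A continuation stays in the copy and decodes to a continuation of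
  \<open>\<delta>\<close>; its left part is empty because the iteration has exited, its right part
  because the residual is maximal.\<close>

lemma maximal_rhs:
  assumes g: "g \<in> \<Gamma>" and l: "lefts \<delta> \<in> traces (iter r)" "(j, Inr ()) \<in> set (lefts \<delta>)"
    and \<delta>: "rights \<delta> \<in> res g" "\<And>w. rights \<delta> @ w \<in> res g \<Longrightarrow> w = []"
  shows "loops n @ map (\<lambda>h. (n, Inr h)) (\<phi> g # map (case_sum (\<rho> g) \<phi>) \<delta>) \<in> max_traces rhs"
    (is "loops n @ map _ ?\<eta> \<in> _")
proof (rule max_tracesI)
  have "?\<eta> \<in> traces \<H>" unfolding traces_\<H> using g l(1) \<delta>(1) by blast
  then show "loops n @ map (\<lambda>h. (n, Inr h)) ?\<eta> \<in> traces rhs" unfolding traces_star by blast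
next
  fix \<beta> assume "(loops n @ map (\<lambda>h. (n, Inr h)) ?\<eta>) @ \<beta> \<in> traces rhs"
  then obtain \<zeta> where "?\<eta> @ \<zeta> \<in> traces \<H>" and \<beta>: "\<beta> = map (\<lambda>h. (n, Inr h)) \<zeta>"
    using star_trace_extension[of n ?\<eta> \<beta> r \<H>] by auto
  then obtain g' \<delta>' where eq: "?\<eta> @ \<zeta> = \<phi> g' # map (case_sum (\<rho> g') \<phi>) \<delta>'"
    and \<delta>': "lefts \<delta>' \<in> traces (iter r)" "rights \<delta>' \<in> res g'"
    unfolding traces_\<H> by auto
  \<comment> \<open>On guards the embedding is \<open>\<phi>\<close>, independently of
    \<open>\<rho>\<close>, so injectivity for the single guard \<open>g\<close> identifies
    \<open>g'\<close>.\<close>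
  have "case_sum (\<rho> g) \<phi> (Inr g) = case_sum (\<rho> g) \<phi> (Inr g')" using eq by simp
  then have "g' = g" using inj[of g] by (metis Inr_inject injD)
  with eq have eq: "map (case_sum (\<rho> g) \<phi>) \<delta> @ \<zeta> = map (case_sum (\<rho> g) \<phi>) \<delta>'" by simp
  have "map (case_sum (\<rho> g) \<phi>) (take (length \<delta>) \<delta>') = map (case_sum (\<rho> g) \<phi>) \<delta>"
    by (simp flip: take_map eq)
  then have "\<delta> = take (length \<delta>) \<delta>'" using inj by (simp add: inj_map_eq_map)
  then obtain w where w: "\<delta>' = \<delta> @ w" by (metis append_take_drop_id)
  then have "lefts w = []" using \<delta>'(1) l(2) by (auto intro: iter_exited)
  moreover have "rights w = []" using \<delta>'(2) \<delta>(2) w \<open>g' = g\<close> by auto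
  ultimately have "w = []" using length_lefts_rights[of w] by simp
  then show "\<beta> = []" using \<beta> w eq by simp
qed

text \<open>As long as the right side has not started, a guard is enabled.\<close>

lemma max_trace_guarded:
  assumes "\<alpha> \<in> max_traces lhs"
  obtains u g \<delta> where "\<alpha> = map Inl u @ Inr g # \<delta>"
proof (cases \<alpha> rule: guard_cases)
  case (1 u)
  obtain g where "g \<in> \<Gamma>" using guards by auto
  then have "\<alpha> @ [Inr g] \<in> traces lhs"
    using max_tracesD(1)[OF assms] guarded_trace[of u g "[]"] by (simp add: 1 unguarded_trace Nil_res)
  then show thesis using max_tracesD(2)[OF assms] by blast
qed (use that in blast)

lemma simulate_weakly_maximal:
  assumes "\<alpha> \<in> max_traces lhs"
  shows "weakly_maximal rhs (simulate \<alpha>)"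
proof -
  obtain u g \<delta> where \<alpha>: "\<alpha> = map Inl u @ Inr g # \<delta>" using max_trace_guarded[OF assms] .
  let ?n = "loop_count u"
  let ?\<delta> = "map (map_sum (shift ?n) id) \<delta>"
  have tr: "u @ lefts \<delta> \<in> traces (iter r)" and g: "g \<in> \<Gamma>" and res: "rights \<delta> \<in> res g"
    using max_tracesD(1)[OF assms] by (simp_all add: \<alpha> guarded_trace)
  \<comment> \<open>The right side moves independently of the iteration, so a longer residual would
    extend \<open>\<alpha>\<close> itself.\<close>
  have max: "w = []" if "rights \<delta> @ w \<in> res g" for w
  proof -
    have "\<alpha> @ map Inr w \<in> traces lhs"
      using that tr g guarded_trace[of u g "\<delta> @ map Inr w"] by (simp add: \<alpha>)
    then show ?thesis using max_tracesD(2)[OF assms] by blast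
  qed
  obtain k where k: "u @ lefts \<delta> = loops k @ [(k, Inr ())]"
    using max_par_iter_exited[OF assms] by (auto simp: \<alpha>)
  have sim: "simulate \<alpha> = loops ?n @ map (\<lambda>h. (?n, Inr h)) (\<phi> g # map (case_sum (\<rho> g) \<phi>) ?\<delta>)"
    by (simp add: \<alpha> simulate_guarded relocate_def)
  have lt: "lefts ?\<delta> \<in> traces (iter r)" using shift_iter_trace[OF tr] by simp
  show ?thesis
  proof (cases "lefts \<delta>" rule: rev_cases)
    case Nil
    \<comment> \<open>Here the exit preceded the guard and was dropped, and the iteration inside the
      copy has not moved; the exit to be added is therefore that of round 0.\<close>
    let ?e = "(?n, Inr (\<rho> g (0, Inr ())))"
    have "loops ?n @ map (\<lambda>h. (?n, Inr h))
        (\<phi> g # map (case_sum (\<rho> g) \<phi>) (?\<delta> @ [Inl (0, Inr ())])) \<in> max_traces rhs"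
      using res max iter_snoc[of "[]" 0 "Inr ()" r]
      by (intro maximal_rhs[where j = 0]) (auto simp: g Nil)
    then have "simulate \<alpha> @ [?e] \<in> max_traces rhs" by (simp add: sim)
    moreover have "skip \<sqsubseteq>\<^sub>H label rhs ?e" by (simp add: label_\<rho>)
    ultimately show ?thesis
      using simulate_trace[OF max_tracesD(1)[OF assms]]
      by (auto simp: weakly_maximal_def intro!: exI[of _ "[?e]"])
  next
    case (snoc v x)
    \<comment> \<open>Here the exit came after the guard, so it is present in the image and nothing
      has to be added.\<close>
    with k have "x = (k, Inr ())" by (metis append_assoc append1_eq_conv)
    with snoc have "(k - ?n, Inr ()) \<in> set (lefts ?\<delta>)" by (simp add: shift_def)
    then have "simulate \<alpha> \<in> max_traces rhs"
      unfolding sim using res max lt g by (intro maximal_rhs) auto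
    then show ?thesis by (auto simp: weakly_maximal_def max_tracesD(1))
  qed
qed

lemma simulate_finite: "finite {\<alpha> \<in> traces lhs. simulate \<alpha> = \<beta>}"
proof (rule finite_subset)
  \<comment> \<open>Right events of a preimage are never dropped, so they can be read off from
    \<open>\<beta>\<close> through the injective \<open>\<phi>\<close>; left events have indices
    bounded by the length of \<open>\<beta>\<close>. The \<open>+ 1\<close> below allows for one
    exit dropped before the guard.\<close>
  let ?R = "{g. \<exists>n. (n, Inr (\<phi> g)) \<in> set \<beta>}"
  let ?A = "Inl ` ({..length \<beta>} \<times> UNIV) \<union> Inr ` ?R :: (nat \<times> (unit + unit) + 'g) set"
  have "inj \<phi>"
  proof (rule injI)
    fix x y assume "\<phi> x = \<phi> y"
    then have "case_sum (\<rho> undefined) \<phi> (Inr x) = case_sum (\<rho> undefined) \<phi> (Inr y)" by simp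
    then show "x = y" using inj by (metis Inr_inject injD)
  qed
  have "?R \<subseteq> \<phi> -` (projr ` snd ` set \<beta>)" by (force simp: image_iff)
  then have "finite ?R"
    using finite_subset finite_vimageI[OF _ \<open>inj \<phi>\<close>] by (metis List.finite_set finite_imageI)
  then show "finite {\<alpha>. set \<alpha> \<subseteq> ?A \<and> length \<alpha> \<le> length \<beta> + 1}"
    by (intro finite_lists_length_le) auto
  show "{\<alpha> \<in> traces lhs. simulate \<alpha> = \<beta>} \<subseteq> \<dots>"
  proof (intro subsetI, elim CollectE conjE, intro CollectI)
    fix \<alpha> assume t: "\<alpha> \<in> traces lhs" and \<beta>: "simulate \<alpha> = \<beta>"
    show "set \<alpha> \<subseteq> ?A \<and> length \<alpha> \<le> length \<beta> + 1"
    proof (cases \<alpha> rule: guard_cases)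
      case (1 u)
      with t have u: "u \<in> traces (iter r)" by (simp add: unguarded_trace)
      have "length \<beta> = loop_count u" using \<beta> by (auto simp: 1 simulate_unguarded)
      then show ?thesis using loop_count_bounds[OF u] by (auto simp: 1)
    next
      case (2 u g \<delta>)
      with t have u: "u @ lefts \<delta> \<in> traces (iter r)" by (simp add: guarded_trace)
      have l: "length \<beta> = loop_count u + 1 + length \<delta>"
        using \<beta> by (auto simp: 2 simulate_guarded)
      have "loop_count (lefts \<delta>) \<le> length (lefts \<delta>)" by (simp add: loop_count_def)
      then have b: "loop_count (u @ lefts \<delta>) \<le> length \<beta>"
        using l length_lefts_rights[of \<delta>] by simp
      have "length u \<le> Suc (loop_count u)"
        using loop_count_bounds(1) traces_appendD[OF u] by blast
      then have "length \<alpha> \<le> length \<beta> + 1" by (simp add: 2 l)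
      moreover have "e \<in> ?A" if "e \<in> set \<alpha>" for e
      proof (cases e)
        case (Inl x)
        with that have "(fst x, snd x) \<in> set (u @ lefts \<delta>)" by (auto simp: 2 set_lefts)
        from loop_count_bounds(2)[OF u this] b show ?thesis using Inl by (cases x) auto
      next
        case (Inr g')
        then have "(loop_count u, Inr (\<phi> g')) \<in> set \<beta>"
          using that by (auto simp: 2 simulate_guarded image_iff relocate_def simp flip: \<beta>
              intro!: bexI[of _ "Inr g'"])
        then show ?thesis using Inr by auto
      qed
      ultimately show ?thesis by blast
    qed
  qed
qed

lemma sim_guarded_choice: "lhs \<sqsubseteq>\<^sub>s\<^sub>i\<^sub>m rhs"
  unfolding sim_def t_simulation_def
proof (intro exI[of _ simulate] conjI ballI allI impI)
  show "simulate [] = []" using simulate_unguarded[of "[]"] by simp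
next
  fix \<alpha> e assume "\<alpha> @ [e] \<in> traces lhs"
  from simulate_step[OF this] trace_events simulate_trace[OF this]
  show "(simulate (\<alpha> @ [e]) = simulate \<alpha> \<and> label lhs e \<sqsubseteq>\<^sub>H skip) \<or>
      (\<exists>e'\<in>events rhs. label lhs e \<sqsubseteq>\<^sub>H label rhs e' \<and> simulate (\<alpha> @ [e]) = simulate \<alpha> @ [e'])"
    by (metis prog_le_refl)
next
  fix \<alpha> e assume max: "\<alpha> @ [e] \<in> max_traces lhs"
  obtain u g \<delta> where "\<alpha> @ [e] = map Inl u @ Inr g # \<delta>" using max_trace_guarded[OF max] .
  from simulate_step_guarded[OF this] trace_events simulate_trace[OF max_tracesD(1)[OF max]]
  show "\<exists>e'\<in>events rhs. label lhs e \<sqsubseteq>\<^sub>H label rhs e' \<and> simulate (\<alpha> @ [e]) = simulate \<alpha> @ [e']"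
    by (metis prog_le_refl)
qed (simp_all add: simulate_trace simulate_finite simulate_weakly_maximal)

end

section \<open>The three guarded instances\<close>

lemma rights_eq_mapE:
  assumes "rights \<delta> = map h \<gamma>"
  obtains \<delta>' where "\<delta> = map (map_sum id h) \<delta>'" "rights \<delta>' = \<gamma>"
proof -
  have "\<exists>\<delta>'. \<delta> = map (map_sum id h) \<delta>' \<and> rights \<delta>' = \<gamma>"
    using assms
  proof (induction \<delta> arbitrary: \<gamma>)
    case (Cons x \<delta>)
    show ?case
    proof (cases x)
      case (Inl a)
      with Cons.prems have "rights \<delta> = map h \<gamma>" by simp
      with Cons.IH obtain \<delta>' where "\<delta> = map (map_sum id h) \<delta>'" "rights \<delta>' = \<gamma>" by blast
      with Inl show ?thesis by (intro exI[of _ "Inl a # \<delta>'"]) (simp add: id_def)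
    next
      case (Inr b)
      with Cons.prems obtain y \<gamma>' where y: "\<gamma> = y # \<gamma>'" "b = h y" "rights \<delta> = map h \<gamma>'"
        by auto
      with Cons.IH obtain \<delta>' where "\<delta> = map (map_sum id h) \<delta>'" "rights \<delta>' = \<gamma>'" by blast
      with Inr y show ?thesis by (intro exI[of _ "Inr y # \<delta>'"]) (simp add: id_def)
    qed
  qed simp
  with that show thesis by blast
qed

text \<open>The residuals in \<open>\<G>\<close> are traces of \<open>\<E>\<close> tagged by some
  \<open>h\<close>, while the copy contains tagged shuffles. Tagging before or after shuffling gives
  the same lists, which brings the latter into the form that the locale demands.\<close>

lemma map_par_traces:
  "map (case_sum \<rho> (\<phi> \<circ> h)) ` traces (\<D> \<parallel>\<^sub>b \<E>) =
     {map (case_sum \<rho> \<phi>) \<delta> |\<delta>. lefts \<delta> \<in> traces \<D> \<and> rights \<delta> \<in> map h ` traces \<E>}"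
proof -
  have comp: "case_sum \<rho> (\<phi> \<circ> h) = case_sum \<rho> \<phi> \<circ> map_sum id h"
    by (auto simp: fun_eq_iff split: sum.splits)
  have "map (case_sum \<rho> \<phi>) (map (map_sum id h) \<delta>) \<in>
      {map (case_sum \<rho> \<phi>) \<delta> |\<delta>. lefts \<delta> \<in> traces \<D> \<and> rights \<delta> \<in> map h ` traces \<E>}"
    if "\<delta> \<in> traces (\<D> \<parallel>\<^sub>b \<E>)" for \<delta>
    using that by (intro CollectI exI[of _ "map (map_sum id h) \<delta>"]) (simp add: traces_par)
  moreover have "map (case_sum \<rho> \<phi>) \<delta> \<in> (\<lambda>\<delta>. map (case_sum \<rho> \<phi>) (map (map_sum id h) \<delta>)) ` traces (\<D> \<parallel>\<^sub>b \<E>)"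
    if l: "lefts \<delta> \<in> traces \<D>" and r: "rights \<delta> \<in> map h ` traces \<E>" for \<delta>
  proof -
    from r obtain \<gamma> where \<gamma>: "rights \<delta> = map h \<gamma>" "\<gamma> \<in> traces \<E>" by auto
    obtain \<delta>' where \<delta>': "\<delta> = map (map_sum id h) \<delta>'" "rights \<delta>' = \<gamma>"
      using rights_eq_mapE[OF \<gamma>(1)] .
    have "\<delta>' \<in> traces (\<D> \<parallel>\<^sub>b \<E>)" using l \<gamma> \<delta>' by (simp add: traces_par)
    then show ?thesis using \<delta>' by blast
  qed
  ultimately show ?thesis unfolding comp map_map[symmetric] by blast
qed

lemma sim_iter_par_atomic:
  fixes r r' :: "'s::finite prog"
  shows "(iter r \<parallel>\<^sub>b atomic r') \<sqsubseteq>\<^sub>s\<^sub>i\<^sub>m (atomic r \<star>\<^sub>b (atomic r' \<cdot>\<^sub>b iter r))"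
proof -
  \<comment> \<open>The guard is the single event of \<open>atomic r'\<close>, and nothing remains
    after it; the shuffles therefore shrink to traces of the iteration alone.\<close>
  interpret guarded_choice r "atomic r'" "atomic r' \<cdot>\<^sub>b iter r" UNIV "\<lambda>_. {[]}" Inl "\<lambda>_. Inr"
  proof
    have "map Inr ` traces (iter r) = {map (case_sum Inr Inl) \<delta> |\<delta>.
        lefts \<delta> \<in> traces (iter r) \<and> rights \<delta> \<in> {[] :: unit list}}" (is "?C = ?D")
    proof (intro equalityI subsetI)
      fix x :: "(unit + nat \<times> (unit + unit)) list" assume "x \<in> ?C"
      then obtain \<gamma> where "\<gamma> \<in> traces (iter r)" "x = map (case_sum Inr Inl) (map Inl \<gamma>)" by auto
      then show "x \<in> ?D" by (intro CollectI exI[of _ "map Inl \<gamma>"]) simp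
    next
      fix x assume "x \<in> ?D"
      then obtain \<delta> :: "(nat \<times> (unit + unit) + unit) list"
        where "x = map (case_sum Inr Inl) \<delta>" "lefts \<delta> \<in> traces (iter r)" "\<delta> = map Inl (lefts \<delta>)"
        by (auto simp: rights_empty_iff)
      moreover from this have "x = map Inr (lefts \<delta>)"
        by (metis (no_types, lifting) list.map_comp list.map_cong0 o_apply sum.case(1))
      ultimately show "x \<in> ?C" by blast
    qed
    then show "traces (atomic r' \<cdot>\<^sub>b iter r) = insert [] {Inl g # map (case_sum Inr Inl) \<delta> |g \<delta>.
        g \<in> UNIV \<and> lefts \<delta> \<in> traces (iter r) \<and> rights \<delta> \<in> {[]}}"
      unfolding traces_atomic_seq by (auto simp: set_eq_iff image_iff)
  qed (auto simp: traces_atomic inj_on_def split: sum.splits)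
  show ?thesis by (rule sim_guarded_choice)
qed

lemma sim_iter_par_atomic_seq:
  fixes r r' :: "'s::finite prog" and \<E> :: "('e, 's) bes"
  shows "(iter r \<parallel>\<^sub>b (atomic r' \<cdot>\<^sub>b \<E>)) \<sqsubseteq>\<^sub>s\<^sub>i\<^sub>m (atomic r \<star>\<^sub>b (atomic r' \<cdot>\<^sub>b (iter r \<parallel>\<^sub>b \<E>)))"
proof -
  \<comment> \<open>The action keeps its place, and events of \<open>\<E>\<close> move to the right
    component next to the restarted iteration.\<close>
  let ?\<phi> = "map_sum id Inr :: unit + 'e \<Rightarrow> unit + (nat \<times> (unit + unit) + 'e)"
  let ?\<rho> = "Inr \<circ> Inl :: nat \<times> (unit + unit) \<Rightarrow> unit + (nat \<times> (unit + unit) + 'e)"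
  interpret guarded_choice r "atomic r' \<cdot>\<^sub>b \<E>" "atomic r' \<cdot>\<^sub>b (iter r \<parallel>\<^sub>b \<E>)" "{Inl ()}"
    "\<lambda>_. map Inr ` traces \<E>" ?\<phi> "\<lambda>_. ?\<rho>"
  proof
    have "case_sum ?\<rho> (?\<phi> \<circ> Inr) = Inr" by (auto simp: fun_eq_iff split: sum.splits)
    then have "map Inr ` traces (iter r \<parallel>\<^sub>b \<E>) = {map (case_sum ?\<rho> ?\<phi>) \<delta> |\<delta>.
        lefts \<delta> \<in> traces (iter r) \<and> rights \<delta> \<in> map Inr ` traces \<E>}"
      using map_par_traces[of ?\<rho> ?\<phi> Inr "iter r" \<E>] by simp
    then show "traces (atomic r' \<cdot>\<^sub>b (iter r \<parallel>\<^sub>b \<E>)) = insert [] {?\<phi> g # map (case_sum ?\<rho> ?\<phi>) \<delta> |g \<delta>.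
        g \<in> {Inl ()} \<and> lefts \<delta> \<in> traces (iter r) \<and> rights \<delta> \<in> map Inr ` traces \<E>}"
      unfolding traces_atomic_seq by (auto simp: set_eq_iff image_iff)
  qed (auto simp: traces_atomic_seq inj_on_def map_sum_def split: sum.splits)
  show ?thesis by (rule sim_guarded_choice)
qed

lemma traces_atomic_seq_plus:
  "traces (atomic b \<cdot>\<^sub>b \<E> +\<^sub>b atomic c \<cdot>\<^sub>b \<F>) =
     insert [] ((#) (Inl (Inl ())) ` map (Inl \<circ> Inr) ` traces \<E> \<union>
       (#) (Inr (Inl ())) ` map (Inr \<circ> Inr) ` traces \<F>)"
proof -
  have "traces (atomic b \<cdot>\<^sub>b \<E>) = insert [] ((\<lambda>\<gamma>. Inl () # map Inr \<gamma>) ` traces \<E>)"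
    "traces (atomic c \<cdot>\<^sub>b \<F>) = insert [] ((\<lambda>\<gamma>. Inl () # map Inr \<gamma>) ` traces \<F>)"
    by (auto simp: traces_atomic_seq)
  then show ?thesis by (simp add: traces_plus image_image)
qed

lemma sim_iter_par_choice:
  fixes r b c :: "'s::finite prog" and \<E> :: "('e, 's) bes" and \<F> :: "('f, 's) bes"
  shows "(iter r \<parallel>\<^sub>b (atomic b \<cdot>\<^sub>b \<E> +\<^sub>b atomic c \<cdot>\<^sub>b \<F>)) \<sqsubseteq>\<^sub>s\<^sub>i\<^sub>m
      (atomic r \<star>\<^sub>b (atomic b \<cdot>\<^sub>b (iter r \<parallel>\<^sub>b \<E>) +\<^sub>b atomic c \<cdot>\<^sub>b (iter r \<parallel>\<^sub>b \<F>)))"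
proof -
  let ?\<phi> = "map_sum (map_sum id Inr) (map_sum id Inr) :: (unit + 'e) + (unit + 'f) \<Rightarrow>
    (unit + (nat \<times> (unit + unit) + 'e)) + (unit + (nat \<times> (unit + unit) + 'f))"
  let ?\<rho>1 = "Inl \<circ> Inr \<circ> Inl :: nat \<times> (unit + unit) \<Rightarrow>
    (unit + (nat \<times> (unit + unit) + 'e)) + (unit + (nat \<times> (unit + unit) + 'f))"
  let ?\<rho>2 = "Inr \<circ> Inr \<circ> Inl :: nat \<times> (unit + unit) \<Rightarrow>
    (unit + (nat \<times> (unit + unit) + 'e)) + (unit + (nat \<times> (unit + unit) + 'f))"
  \<comment> \<open>The branch of the guard selects which of the two restarted iterations is
    used.\<close>
  let ?\<rho> = "case_sum (\<lambda>_. ?\<rho>1) (\<lambda>_. ?\<rho>2) :: (unit + 'e) + (unit + 'f) \<Rightarrow> _"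
  let ?res = "case_sum (\<lambda>_. map (Inl \<circ> Inr) ` traces \<E>) (\<lambda>_. map (Inr \<circ> Inr) ` traces \<F>)
    :: (unit + 'e) + (unit + 'f) \<Rightarrow> _"
  interpret guarded_choice r "atomic b \<cdot>\<^sub>b \<E> +\<^sub>b atomic c \<cdot>\<^sub>b \<F>"
    "atomic b \<cdot>\<^sub>b (iter r \<parallel>\<^sub>b \<E>) +\<^sub>b atomic c \<cdot>\<^sub>b (iter r \<parallel>\<^sub>b \<F>)" "{Inl (Inl ()), Inr (Inl ())}" ?res ?\<phi> ?\<rho>
  proof
    have "case_sum ?\<rho>1 (?\<phi> \<circ> (Inl \<circ> Inr)) = Inl \<circ> Inr" "case_sum ?\<rho>2 (?\<phi> \<circ> (Inr \<circ> Inr)) = Inr \<circ> Inr"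
      by (auto simp: fun_eq_iff split: sum.splits)
    then have *: "map (Inl \<circ> Inr) ` traces (iter r \<parallel>\<^sub>b \<E>) = {map (case_sum ?\<rho>1 ?\<phi>) \<delta> |\<delta>.
        lefts \<delta> \<in> traces (iter r) \<and> rights \<delta> \<in> map (Inl \<circ> Inr) ` traces \<E>}"
      "map (Inr \<circ> Inr) ` traces (iter r \<parallel>\<^sub>b \<F>) = {map (case_sum ?\<rho>2 ?\<phi>) \<delta> |\<delta>.
        lefts \<delta> \<in> traces (iter r) \<and> rights \<delta> \<in> map (Inr \<circ> Inr) ` traces \<F>}"
      using map_par_traces[of ?\<rho>1 ?\<phi> "Inl \<circ> Inr" "iter r" \<E>]
        map_par_traces[of ?\<rho>2 ?\<phi> "Inr \<circ> Inr" "iter r" \<F>] by simp_all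
    \<comment> \<open>Splitting over the two guards turns the comprehension of the locale into the
      union of branches in \<open>traces_atomic_seq_plus\<close>.\<close>
    have two: "{F g d |g d. g \<in> {x, y} \<and> P d \<and> Q g d} =
        {F x d |d. P d \<and> Q x d} \<union> {F y d |d. P d \<and> Q y d}"
      for F :: "_ \<Rightarrow> (nat \<times> (unit + unit) + (unit + 'e) + (unit + 'f)) list \<Rightarrow> _" and x y P Q
      by blast
    show "traces (atomic b \<cdot>\<^sub>b (iter r \<parallel>\<^sub>b \<E>) +\<^sub>b atomic c \<cdot>\<^sub>b (iter r \<parallel>\<^sub>b \<F>)) =
        insert [] {?\<phi> g # map (case_sum (?\<rho> g) ?\<phi>) \<delta> |g \<delta>.
          g \<in> {Inl (Inl ()), Inr (Inl ())} \<and> lefts \<delta> \<in> traces (iter r) \<and> rights \<delta> \<in> ?res g}"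
      unfolding traces_atomic_seq_plus * two by (simp add: setcompr_eq_image image_image)
    show "traces (atomic b \<cdot>\<^sub>b \<E> +\<^sub>b atomic c \<cdot>\<^sub>b \<F>) = insert [] {g # \<gamma> |g \<gamma>.
        g \<in> {Inl (Inl ()), Inr (Inl ())} \<and> \<gamma> \<in> ?res g}"
      unfolding traces_atomic_seq_plus by auto
  qed (auto simp: inj_on_def map_sum_def split: sum.splits)
  show ?thesis by (rule sim_guarded_choice)
qed

theorem proposition4p16:
  fixes r r' b c :: "('s::finite) prog"
    and \<E> :: "('e, 's) bes" and \<F> :: "('f, 's) bes"
  assumes "r \<in> H1" and "r' \<in> H1"
    and "b \<in> tests" and "c \<in> tests"
    and "ipbes \<E>" and "ipbes \<F>"
  shows "(iter r \<parallel>\<^sub>b iter r) \<sqsubseteq>\<^sub>s\<^sub>i\<^sub>m iter r \<and>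
    (iter r \<parallel>\<^sub>b atomic r') \<sqsubseteq>\<^sub>s\<^sub>i\<^sub>m (atomic r \<star>\<^sub>b (atomic r' \<cdot>\<^sub>b iter r)) \<and>
    (iter r \<parallel>\<^sub>b (atomic b \<cdot>\<^sub>b \<E> +\<^sub>b atomic c \<cdot>\<^sub>b \<F>)) \<sqsubseteq>\<^sub>s\<^sub>i\<^sub>m
      (atomic r \<star>\<^sub>b (atomic b \<cdot>\<^sub>b (iter r \<parallel>\<^sub>b \<E>) +\<^sub>b atomic c \<cdot>\<^sub>b (iter r \<parallel>\<^sub>b \<F>))) \<and>
    (iter r \<parallel>\<^sub>b (atomic r' \<cdot>\<^sub>b \<E>)) \<sqsubseteq>\<^sub>s\<^sub>i\<^sub>m
      (atomic r \<star>\<^sub>b (atomic r' \<cdot>\<^sub>b (iter r \<parallel>\<^sub>b \<E>)))"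
  using sim_iter_par_iter sim_iter_par_atomic sim_iter_par_choice sim_iter_par_atomic_seq by blast

end
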